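(* Let $R=K[x_1,\ldots,x_n]$ be a polynomial ring over a field $K$, let $I\subset R$ be a monomial ideal without embedded primes, and let $I=\bigcap_{i=1}^r\mathfrak{I}_i$ be its minimal irredundant primary decomposition. If $R[\mathfrak{I}_it]$ is normal for all $i$ and $\mathcal{H}$ is the Hilbert basis of the polyhedral cone $\bigcap_{i=1}^r\mathbb{R}_+(\mathfrak{I}_i)\subset\mathbb{R}^{n+1}$, then $R_s(I)=K[\mathbb{N}\mathcal{H}]$, the semigroup ring of $\mathbb{N}\mathcal{H}$.
   Context: Let $t$ be a new variable. The Rees algebra of an ideal $J\subset R$ is $R[Jt]=R\oplus Jt\oplus\cdots\oplus J^kt^k\oplus\cdots\subset R[t]$. The symbolic Rees algebra of $I$ is $R_s(I)=R\oplus I^{(1)}t\oplus\cdots\oplus I^{(k)}t^k\oplus\cdots\subset R[t]$, where the $k$-th symbolic power is $I^{(k)}=\bigcap_i(I^kR_{\mathfrak{p}_i}\cap R)$, the intersection being over the minimal primes $\mathfrak{p}_i$ of $I$. A domain is normal if it is integrally closed in its field of fractions. For a monomial ideal $J$ with minimal set of monomial generators $\{x^{v_1},\ldots,x^{v_m}\}$, set $\mathcal{A}_J=\{e_1,\ldots,e_n,(v_1,1),\ldots,(v_m,1)\}\subset\mathbb{Z}^{n+1}$, where $e_i$ is the $i$-th unit vector of $\mathbb{Z}^{n+1}$; $\mathbb{R}_+(J)$ denotes the cone $\mathbb{R}_+\mathcal{A}_J$ generated by $\mathcal{A}_J$. For a finite set $\mathcal{H}$, $\mathbb{N}\mathcal{H}$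 is the semigroup of its nonnegative integer combinations and $\mathbb{R}_+\mathcal{H}$ the cone it generates. A finite set $\mathcal{H}$ is a Hilbert basis of a rational polyhedral cone $C\subset\mathbb{R}^{n+1}$ if $C=\mathbb{R}_+\mathcal{H}$ and $\mathbb{N}\mathcal{H}=\mathbb{R}_+\mathcal{H}\cap\mathbb{Z}^{n+1}$ (a pointed cone has a unique minimal Hilbert basis). The semigroup ring $K[\mathbb{N}\mathcal{H}]$ is regarded as the $K$-subalgebra of $R[t]$ spanned by the monomials $x^at^b$ with $(a,b)\in\mathbb{N}\mathcal{H}$. *)

theory Defs
  imports
    "HOL-Analysis.Analysis"
    "HOL-Library.Poly_Mapping"
    "HOL-Computational_Algebra.Polynomial"
    "HOL-Computational_Algebra.Fraction_Field"
begin

text \<open>Ideals are the submodules of the ring, as a module over itself.\<close>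

abbreviation is_ideal :: "'a::comm_ring_1 set \<Rightarrow> bool" where
  "is_ideal \<equiv> module.subspace (*)"

abbreviation ideal_gen :: "'a::comm_ring_1 set \<Rightarrow> 'a set" where
  "ideal_gen \<equiv> module.span (*)"

fun ideal_pow :: "'a::comm_ring_1 set \<Rightarrow> nat \<Rightarrow> 'a set" where
  "ideal_pow J 0 = UNIV"
| "ideal_pow J (Suc k) = ideal_gen {a * b | a b. a \<in> J \<and> b \<in> ideal_pow J k}"

definition prime_ideal :: "'a::comm_ring_1 set \<Rightarrow> bool" where
  "prime_ideal P \<longleftrightarrow> is_ideal P \<and> P \<noteq> UNIV \<and> (\<forall>a b. a * b \<in> P \<longrightarrow> a \<in> P \<or> b \<in> P)"

definition ideal_radical :: "'a::comm_ring_1 set \<Rightarrow> 'a set" where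
  "ideal_radical J = {a. \<exists>m::nat. a ^ m \<in> J}"

definition primary_ideal :: "'a::comm_ring_1 set \<Rightarrow> bool" where
  "primary_ideal Q \<longleftrightarrow> is_ideal Q \<and> Q \<noteq> UNIV \<and>
     (\<forall>a b. a * b \<in> Q \<longrightarrow> a \<in> Q \<or> b \<in> ideal_radical Q)"

definition minimal_primes :: "'a::comm_ring_1 set \<Rightarrow> 'a set set" where
  "minimal_primes I = {P. prime_ideal P \<and> I \<subseteq> P \<and>
     (\<forall>P'. prime_ideal P' \<and> I \<subseteq> P' \<and> P' \<subseteq> P \<longrightarrow> P' = P)}"

text \<open>The associated primes of \<open>R/I\<close>: annihilators, when prime, of residue classes \<open>f + I\<close>.\<close>

definition associated_primes :: "'a::comm_ring_1 set \<Rightarrow> 'a set set" where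
  "associated_primes I = {P. prime_ideal P \<and> (\<exists>f. P = {g. g * f \<in> I})}"

definition embedded_primes :: "'a::comm_ring_1 set \<Rightarrow> 'a set set" where
  "embedded_primes I = associated_primes I - minimal_primes I"

definition minimal_primary_decomposition ::
    "'a::comm_ring_1 set \<Rightarrow> nat \<Rightarrow> (nat \<Rightarrow> 'a set) \<Rightarrow> bool" where
  "minimal_primary_decomposition I r Q \<longleftrightarrow>
     I = (\<Inter>i\<in>{1..r}. Q i) \<and>
     (\<forall>i\<in>{1..r}. primary_ideal (Q i)) \<and>
     inj_on (\<lambda>i. ideal_radical (Q i)) {1..r} \<and>
     (\<forall>i\<in>{1..r}. (\<Inter>j\<in>{1..r} - {i}. Q j) \<noteq> I)"

abbreviation to_fract :: "'a::idom \<Rightarrow> 'a fract" where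
  "to_fract a \<equiv> Fract a 1"

text \<open>The localization \<open>R\<^sub>P\<close>, as a subring of the field of fractions of the domain \<open>R\<close>,
  and the extended ideal \<open>J R\<^sub>P\<close>, the finite \<open>R\<^sub>P\<close>-linear combinations of elements of \<open>J\<close>.\<close>

definition localization :: "'a::idom set \<Rightarrow> 'a fract set" where
  "localization P = {Fract a s | a s. s \<notin> P}"

definition extended_ideal :: "'a::idom set \<Rightarrow> 'a set \<Rightarrow> 'a fract set" where
  "extended_ideal J P =
     {\<Sum>a\<in>F. c a * to_fract a | F c. finite F \<and> F \<subseteq> J \<and> (\<forall>a\<in>F. c a \<in> localization P)}"

definition symbolic_power :: "'a::idom set \<Rightarrow> nat \<Rightarrow> 'a set" where
  "symbolic_power I k =
     (\<Inter>P\<in>minimal_primes I. {f. to_fract f \<in> extended_ideal (ideal_pow I k) P})"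

text \<open>The polynomial ring \<open>R[t]\<close> is the type \<open>'a poly\<close>; a graded subalgebra
  \<open>R \<oplus> J\<^sub>1 t \<oplus> J\<^sub>2 t^2 \<oplus> \<dots>\<close> is the set of polynomials whose \<open>k\<close>-th coefficient lies in \<open>J\<^sub>k\<close>.\<close>

definition rees_algebra :: "'a::comm_ring_1 set \<Rightarrow> 'a poly set" where
  "rees_algebra J = {p. \<forall>k. coeff p k \<in> ideal_pow J k}"

definition symbolic_rees_algebra :: "'a::idom set \<Rightarrow> 'a poly set" where
  "symbolic_rees_algebra I = {p. \<forall>k. coeff p k \<in> symbolic_power I k}"

text \<open>For a subring \<open>A\<close> of a domain, the field of fractions of \<open>A\<close> is taken inside that of the
  ambient domain.\<close>

definition subring_fractions :: "'a::idom set \<Rightarrow> 'a fract set" where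
  "subring_fractions A = {Fract a b | a b. a \<in> A \<and> b \<in> A \<and> b \<noteq> 0}"

definition integral_over :: "'a::idom set \<Rightarrow> 'a fract \<Rightarrow> bool" where
  "integral_over A z \<longleftrightarrow>
     (\<exists>p :: 'a fract poly. lead_coeff p = 1 \<and> (\<forall>i. coeff p i \<in> to_fract ` A) \<and> poly p z = 0)"

definition normal_subring :: "'a::idom set \<Rightarrow> bool" where
  "normal_subring A \<longleftrightarrow> (\<forall>z\<in>subring_fractions A. integral_over A z \<longrightarrow> z \<in> to_fract ` A)"

text \<open>The ring \<open>K[x\<^sub>1, \<dots>, x\<^sub>n]\<close>, with the variables indexed by a finite type \<open>'n\<close>. When \<open>'n\<close> is
  linearly ordered and \<open>'k\<close> is a field, the library makes this type an instance of \<open>idom\<close>.\<close>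

type_synonym ('n, 'k) polynomial_ring = "('n \<Rightarrow>\<^sub>0 nat) \<Rightarrow>\<^sub>0 'k"

abbreviation monomial :: "('n \<Rightarrow>\<^sub>0 nat) \<Rightarrow> ('n, 'k::comm_ring_1) polynomial_ring" where
  "monomial a \<equiv> Poly_Mapping.single a 1"

definition monomial_ideal :: "('n, 'k::comm_ring_1) polynomial_ring set \<Rightarrow> bool" where
  "monomial_ideal J \<longleftrightarrow> (\<exists>G. J = ideal_gen (monomial ` G))"

definition is_min_gens ::
    "('n, 'k::comm_ring_1) polynomial_ring set \<Rightarrow> ('n \<Rightarrow>\<^sub>0 nat) set \<Rightarrow> bool" where
  "is_min_gens J G \<longleftrightarrow> ideal_gen (monomial ` G) = J \<and>
     (\<forall>G'. G' \<subset> G \<longrightarrow> ideal_gen (monomial ` G') \<noteq> J)"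

text \<open>The exponents of the minimal set of monomial generators; see \<open>ex1_min_gens\<close> below.\<close>

definition min_gens ::
    "('n, 'k::comm_ring_1) polynomial_ring set \<Rightarrow> ('n \<Rightarrow>\<^sub>0 nat) set" where
  "min_gens J = (THE G. is_min_gens J G)"

text \<open>\<open>(real^'n) \<times> real\<close> plays the role of \<open>\<real>^(n+1)\<close>, the last coordinate being the exponent
  of \<open>t\<close>.\<close>

definition exponent_point :: "('n::finite \<Rightarrow>\<^sub>0 nat) \<Rightarrow> nat \<Rightarrow> (real^'n) \<times> real" where
  "exponent_point a b = (\<chi> i. real (Poly_Mapping.lookup a i), real b)"

definition lattice_points :: "((real^'n) \<times> real) set" where
  "lattice_points = {(u, s). (\<forall>i. u $ i \<in> \<int>) \<and> s \<in> \<int>}"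

definition rees_cone :: "('n::finite, 'k::comm_ring_1) polynomial_ring set \<Rightarrow> ((real^'n) \<times> real) set"
  where
  "rees_cone J = convex_cone hull
     (range (\<lambda>i. (axis i 1, 0)) \<union> (\<lambda>v. exponent_point v 1) ` min_gens J)"

definition nat_combinations :: "'v::real_vector set \<Rightarrow> 'v set" where
  "nat_combinations H = {\<Sum>h\<in>H. real (c h) *\<^sub>R h | c :: 'v \<Rightarrow> nat. True}"

definition hilbert_basis :: "((real^'n) \<times> real) set \<Rightarrow> ((real^'n) \<times> real) set \<Rightarrow> bool" where
  "hilbert_basis H C \<longleftrightarrow> finite H \<and> C = convex_cone hull H \<and>
     nat_combinations H = convex_cone hull H \<inter> lattice_points"

text \<open>The \<open>K\<close>-span in \<open>R[t]\<close> of the monomials \<open>x^a t^b\<close> with \<open>(a, b) \<in> S\<close>.\<close>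

definition semigroup_ring ::
    "((real^'n) \<times> real) set \<Rightarrow> ('n::finite, 'k::field) polynomial_ring poly set" where
  "semigroup_ring S = module.span (\<lambda>c. smult (Poly_Mapping.single 0 c))
     {monom (monomial a) b | a b. exponent_point a b \<in> S}"

lemma module_mult: "module ((*) :: 'a::comm_ring_1 \<Rightarrow> 'a \<Rightarrow> 'a)"
  by unfold_locales (simp_all add: algebra_simps)

lemma self_witness:
  fixes x :: "'a::comm_monoid_add"
  shows "x \<in> A \<Longrightarrow> \<exists>w\<in>A. \<exists>u. x = w + u"
  by (metis add_0_right)

lemma monomial_in_ideal_gen:
  fixes G :: "('n \<Rightarrow>\<^sub>0 nat) set"
  shows "(monomial v :: ('n, 'k::comm_ring_1) polynomial_ring) \<in> ideal_gen (monomial ` G)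
    \<longleftrightarrow> (\<exists>w\<in>G. \<exists>u. v = w + u)"
proof
  let ?S = "{f :: ('n, 'k) polynomial_ring. \<forall>v\<in>Poly_Mapping.keys f. \<exists>w\<in>G. \<exists>u. v = w + u}"
  have "is_ideal ?S"
  proof (subst module.subspace_def[OF module_mult], intro conjI ballI allI)
    fix f g assume "f \<in> ?S" "g \<in> ?S"
    then show "f + g \<in> ?S"
      using keys_add[of f g] by blast
  next
    fix c f assume f: "f \<in> ?S"
    have "\<exists>w\<in>G. \<exists>u. v = w + u" if v: "v \<in> Poly_Mapping.keys (c * f)" for v
    proof -
      obtain a b where "v = a + b" "b \<in> Poly_Mapping.keys f"
        using v keys_mult[of c f] by blast
      moreover obtain w u where "w \<in> G" "b = w + u"
        using f \<open>b \<in> Poly_Mapping.keys f\<close> by blast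
      ultimately have "v = w + (a + u)" by (simp add: ac_simps)
      then show ?thesis using \<open>w \<in> G\<close> by blast
    qed
    then show "c * f \<in> ?S" by blast
  qed simp
  moreover have "monomial ` G \<subseteq> ?S"
    by (simp add: image_subset_iff self_witness)
  ultimately have sub: "ideal_gen (monomial ` G) \<subseteq> ?S"
    by (rule module.span_minimal[OF module_mult, rotated])
  assume "(monomial v :: ('n, 'k) polynomial_ring) \<in> ideal_gen (monomial ` G)"
  with sub have "(monomial v :: ('n, 'k) polynomial_ring) \<in> ?S" by blast
  then show "\<exists>w\<in>G. \<exists>u. v = w + u" by simp
next
  assume "\<exists>w\<in>G. \<exists>u. v = w + u"
  then obtain w u where "w \<in> G" and v: "v = w + u" by blast
  then have "monomial u * (monomial w :: ('n, 'k) polynomial_ring) \<in> ideal_gen (monomial ` G)"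
    by (intro module.span_scale[OF module_mult] module.span_base[OF module_mult]) auto
  then show "(monomial v :: ('n, 'k) polynomial_ring) \<in> ideal_gen (monomial ` G)"
    by (simp add: v mult_single add.commute)
qed

lemma ideal_gen_monomials_mono:
  fixes G H :: "('n \<Rightarrow>\<^sub>0 nat) set"
  assumes "\<And>v. v \<in> G \<Longrightarrow> \<exists>w\<in>H. \<exists>u. v = w + u"
  shows "(ideal_gen (monomial ` G) :: ('n, 'k::comm_ring_1) polynomial_ring set)
    \<subseteq> ideal_gen (monomial ` H)"
  using assms
  by (intro module.span_minimal[OF module_mult] module.subspace_span[OF module_mult])
    (simp add: image_subset_iff monomial_in_ideal_gen)

lemma exponent_add_cancel:
  fixes u w :: "'n \<Rightarrow>\<^sub>0 nat"
  assumes "u + w = 0"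
  shows "w = 0"
proof (rule poly_mapping_eqI)
  fix i
  have "Poly_Mapping.lookup u i + Poly_Mapping.lookup w i = 0"
    using assms by (metis lookup_add lookup_zero)
  then show "Poly_Mapping.lookup w i = Poly_Mapping.lookup 0 i" by simp
qed

lemma min_gens_unique_aux:
  fixes J :: "('n, 'k::comm_ring_1) polynomial_ring set"
  assumes G: "is_min_gens J G" and H: "is_min_gens J H"
  shows "G \<subseteq> H"
proof
  fix v assume v: "v \<in> G"
  have GH: "ideal_gen (monomial ` G) = J" "ideal_gen (monomial ` H) = J"
    using G H by (auto simp: is_min_gens_def)
  have in_J: "(monomial x \<in> J) = (\<exists>w\<in>G. \<exists>u. x = w + u)"
    "(monomial x \<in> J) = (\<exists>w\<in>H. \<exists>u. x = w + u)" for x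
    using monomial_in_ideal_gen[of x G, where 'k='k] monomial_in_ideal_gen[of x H, where 'k='k]
    unfolding GH by auto
  have "monomial v \<in> J" unfolding in_J(1) using v by (rule self_witness)
  then obtain w u where w: "w \<in> H" "v = w + u" unfolding in_J(2) by blast
  have "monomial w \<in> J" unfolding in_J(2) using w(1) by (rule self_witness)
  then obtain z y where z: "z \<in> G" "w = z + y" unfolding in_J(1) by blast
  have vz: "v = z + (y + u)" using w z by (simp add: ac_simps)
  have "z = v"
  proof (rule ccontr)
    assume "z \<noteq> v"
    have "ideal_gen (monomial ` G) \<subseteq> (ideal_gen (monomial ` (G - {v})) :: ('n, 'k) polynomial_ring set)"
    proof (rule ideal_gen_monomials_mono)
      fix x assume "x \<in> G"
      show "\<exists>w\<in>G - {v}. \<exists>u. x = w + u"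
      proof (cases "x = v")
        case True
        then show ?thesis using vz z \<open>z \<noteq> v\<close> by blast
      next
        case False
        then show ?thesis using \<open>x \<in> G\<close> by (intro self_witness) simp
      qed
    qed
    moreover have "(ideal_gen (monomial ` (G - {v})) :: ('n, 'k) polynomial_ring set)
        \<subseteq> ideal_gen (monomial ` G)"
      by (rule module.span_mono[OF module_mult]) auto
    moreover have "G - {v} \<subset> G" using v by blast
    ultimately show False using G GH unfolding is_min_gens_def by blast
  qed
  then have "y + u = 0" using vz by simp
  then have "u = 0" by (rule exponent_add_cancel)
  then show "v \<in> H" using w by simp
qed

lemma ex1_min_gens:
  fixes J :: "('n::finite, 'k::comm_ring_1) polynomial_ring set"
  assumes "monomial_ideal J"
  shows "\<exists>!G. is_min_gens J G"
proof (rule ex_ex1I)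
  obtain G where J: "J = ideal_gen (monomial ` G)"
    using assms by (auto simp: monomial_ideal_def)
  define d where "d v = (\<Sum>i\<in>UNIV. Poly_Mapping.lookup v i)" for v :: "'n \<Rightarrow>\<^sub>0 nat"
  have d_add: "d (v + w) = d v + d w" for v w
    by (simp add: d_def lookup_add sum.distrib)
  have d_0: "v = 0" if "d v = 0" for v
    using that by (intro poly_mapping_eqI) (simp add: d_def)
  define M where "M = {v \<in> G. \<forall>w\<in>G. \<forall>u. v = w + u \<longrightarrow> w = v}"
  have M: "\<exists>w\<in>M. \<exists>u. v = w + u" if "v \<in> G" for v
    using that
  proof (induction "d v" arbitrary: v rule: less_induct)
    case less
    show ?case
    proof (cases "v \<in> M")
      case True
      then show ?thesis by (rule self_witness)
    next
      case False
      then obtain w u where w: "w \<in> G" "v = w + u" "w \<noteq> v"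
        using less.prems by (auto simp: M_def)
      then have "d u \<noteq> 0" using d_0 by auto
      then have "d w < d v" by (simp add: w(2) d_add)
      then obtain z y where "z \<in> M" "w = z + y" using less.hyps w(1) by blast
      then have "v = z + (y + u)" using w by (simp add: ac_simps)
      then show ?thesis using \<open>z \<in> M\<close> by blast
    qed
  qed
  have "ideal_gen (monomial ` M) = J"
  proof
    show "J \<subseteq> ideal_gen (monomial ` M)"
      unfolding J by (rule ideal_gen_monomials_mono) (rule M)
    show "ideal_gen (monomial ` M) \<subseteq> J"
      unfolding J by (rule module.span_mono[OF module_mult]) (auto simp: M_def)
  qed
  moreover have "ideal_gen (monomial ` G') \<noteq> J" if sub: "G' \<subset> M" for G'
  proof
    assume eq: "ideal_gen (monomial ` G') = J"
    obtain v where v: "v \<in> M" "v \<notin> G'" using sub by blast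
    have "(monomial v :: ('n, 'k) polynomial_ring) \<in> ideal_gen (monomial ` M)"
      using v by (intro module.span_base[OF module_mult]) auto
    then have "(monomial v :: ('n, 'k) polynomial_ring) \<in> ideal_gen (monomial ` G')"
      by (simp add: eq \<open>ideal_gen (monomial ` M) = J\<close>)
    then obtain w u where w: "w \<in> G'" "v = w + u"
      unfolding monomial_in_ideal_gen by blast
    moreover have "w \<in> G" using w(1) sub by (auto simp: M_def)
    ultimately have "w = v" using v(1) unfolding M_def by blast
    then show False using w v by blast
  qed
  ultimately show "\<exists>G. is_min_gens J G"
    unfolding is_min_gens_def by blast
next
  fix G H assume "is_min_gens J G" "is_min_gens J H"
  then show "G = H" by (intro equalityI min_gens_unique_aux)
qed

end

theory Submission
  imports Defs "HOL-Analysis.Kronecker_Approximation_Theorem"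
begin

text \<open>
  Write \<open>P\<^sub>i\<close> for the radical of \<open>Q i\<close>. The symbolic powers of \<open>I\<close> are the intersections of the powers
  of the primary components, and normality identifies the monomials of these powers with the lattice
  points of the Rees cones. So \<open>x^a t^k\<close> lies in the symbolic Rees algebra if and only if \<open>(a, k)\<close> lies in
  the intersection of the cones, whose lattice points are \<open>nat_combinations H\<close>. All ideals in sight
  being monomial, an element is in one of these algebras if and only if its monomials are.

  It has to be shown that the components are monomial. Comparing leading terms shows that \<open>P\<^sub>i\<close> is a
  monomial ideal (\<open>monomial_ideal_radical\<close>). It is therefore generated by variables, and multiplying
  a suitable element by these variables as long as it stays outside \<open>Q i\<close> shows that \<open>P\<^sub>i\<close> is
  associated to \<open>I\<close>, hence minimal over \<open>I\<close> (\<open>radical_minimal_prime\<close>). A monomial outside \<open>P\<^sub>i\<close> then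
  multiplies \<open>Q i\<close> into \<open>I\<close> (\<open>ex_monomial_multiplier\<close>), so \<open>Q i\<close> is monomial and agrees with \<open>I\<close> after
  localization at \<open>P\<^sub>i\<close>. Powers of \<open>Q i\<close> allow the cancellation of elements outside \<open>P\<^sub>i\<close>
  (\<open>ideal_pow_cancel\<close>), and this gives \<open>symbolic_power_eq\<close>.

  A lattice point \<open>(a, k)\<close> of the Rees cone of a monomial ideal has a multiple that is a nonnegative
  integer combination of the generators (\<open>rees_cone_multiple_in_pow\<close>). Hence \<open>x^a t^k\<close> is integral over
  the Rees algebra, and belongs to it if the Rees algebra is normal (\<open>normal_rees_cone_in_pow\<close>).
\<close>

abbreviation keys where "keys \<equiv> Poly_Mapping.keys"
abbreviation lookup where "lookup \<equiv> Poly_Mapping.lookup"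

section \<open>Monomial ideals and their powers\<close>

lemmas ideal_def = module.subspace_def[OF module_mult]

lemma ideal_closed:
  assumes "is_ideal J"
  shows "0 \<in> J" "\<And>a b. a \<in> J \<Longrightarrow> b \<in> J \<Longrightarrow> a + b \<in> J" "\<And>a b. a \<in> J \<Longrightarrow> b \<in> J \<Longrightarrow> a - b \<in> J"
    "\<And>c a. a \<in> J \<Longrightarrow> c * a \<in> J" "\<And>c a. a \<in> J \<Longrightarrow> a * c \<in> J" "\<And>a. a \<in> J \<Longrightarrow> - a \<in> J"
    "\<And>f F. (\<And>i. i \<in> F \<Longrightarrow> f i \<in> J) \<Longrightarrow> sum f F \<in> J"
proof -
  show "0 \<in> J" "\<And>a b. a \<in> J \<Longrightarrow> b \<in> J \<Longrightarrow> a + b \<in> J" "\<And>c a. a \<in> J \<Longrightarrow> c * a \<in> J"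
    using assms by (auto simp: ideal_def)
  then show "\<And>c a. a \<in> J \<Longrightarrow> a * c \<in> J" by (metis mult.commute)
  show "\<And>a b. a \<in> J \<Longrightarrow> b \<in> J \<Longrightarrow> a - b \<in> J"
    using module.subspace_diff[OF module_mult assms] .
  show "\<And>a. a \<in> J \<Longrightarrow> - a \<in> J"
    using module.subspace_neg[OF module_mult assms] .
  show "\<And>f F. (\<And>i. i \<in> F \<Longrightarrow> f i \<in> J) \<Longrightarrow> sum f F \<in> J"
    using module.subspace_sum[OF module_mult assms] .
qed

lemma ideal_pow_is_ideal: "is_ideal (ideal_pow J k)"
  by (cases k) (simp_all add: module.subspace_span[OF module_mult] module.subspace_UNIV[OF module_mult])

lemma ideal_pow_mono: "I \<subseteq> J \<Longrightarrow> ideal_pow I k \<subseteq> ideal_pow J k"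
proof (induction k)
  case (Suc k)
  then show ?case by (auto intro!: module.span_mono[OF module_mult])
qed simp

definition exps :: "('n, 'k::comm_ring_1) polynomial_ring set \<Rightarrow> ('n \<Rightarrow>\<^sub>0 nat) set" where
  "exps J = {a. monomial a \<in> J}"

lemma monomial_add: "monomial (a + b) = monomial a * monomial b"
  by (simp add: mult_single)

lemma single_eq_scaled_monomial:
  "Poly_Mapping.single a c = Poly_Mapping.single 0 c * monomial a"
  by (simp add: mult_single)

lemma keys_remove_term:
  fixes f :: "'a \<Rightarrow>\<^sub>0 'b::ab_group_add"
  shows "keys (f - Poly_Mapping.single a (lookup f a)) = keys f - {a}"
  by (auto simp: in_keys_iff lookup_minus lookup_single when_def split: if_splits)

lemma exps_add_left:
  assumes "is_ideal J" "b \<in> exps J"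
  shows "a + b \<in> exps J"
  using assms ideal_closed(4)[of J "monomial b" "monomial a"]
  unfolding exps_def by (simp add: monomial_add del: mult_single)

lemma exps_add_right:
  assumes "is_ideal J" "b \<in> exps J"
  shows "b + a \<in> exps J"
  using exps_add_left[OF assms] by (simp add: add.commute)

text \<open>By induction on the number of terms: one term is removed at a time.\<close>

lemma in_ideal_if_keys_subset_exps:
  assumes J: "is_ideal J" and "keys f \<subseteq> exps J"
  shows "f \<in> J"
  using assms(2)
proof (induction "card (keys f)" arbitrary: f)
  case 0
  then have "f = 0" by simp
  then show ?case using ideal_closed(1)[OF J] by simp
next
  case (Suc n)
  then obtain a where a: "a \<in> keys f" by fastforce
  define g where "g = f - Poly_Mapping.single a (lookup f a)"
  have kg: "keys g = keys f - {a}" unfolding g_def by (rule keys_remove_term)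
  have "g \<in> J"
    using Suc a by (intro Suc.hyps(1)) (auto simp: kg)
  moreover have "Poly_Mapping.single a (lookup f a) \<in> J"
    using a Suc.prems J ideal_closed(4)[OF J] by (subst single_eq_scaled_monomial) (auto simp: exps_def)
  ultimately have "g + Poly_Mapping.single a (lookup f a) \<in> J"
    using ideal_closed(2)[OF J] by blast
  then show ?case by (simp add: g_def)
qed

lemma keys_subset_is_ideal:
  fixes E :: "('n \<Rightarrow>\<^sub>0 nat) set"
  assumes "\<And>a b. b \<in> E \<Longrightarrow> a + b \<in> E"
  shows "is_ideal {f :: ('n, 'k::comm_ring_1) polynomial_ring. keys f \<subseteq> E}"
  unfolding ideal_def
proof (intro conjI ballI allI)
  show "(0 :: ('n, 'k) polynomial_ring) \<in> {f. keys f \<subseteq> E}" by simp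
next
  fix f g :: "('n, 'k) polynomial_ring" assume "f \<in> {f. keys f \<subseteq> E}" "g \<in> {f. keys f \<subseteq> E}"
  then show "f + g \<in> {f. keys f \<subseteq> E}" using keys_add[of f g] by blast
next
  fix c f :: "('n, 'k) polynomial_ring" assume "f \<in> {f. keys f \<subseteq> E}"
  then show "c * f \<in> {f. keys f \<subseteq> E}" using keys_mult[of c f] assms by blast
qed

text \<open>An ideal is monomial exactly if it contains the monomials of each of its elements; this makes
  it the set of polynomials supported in \<open>exps J\<close>, an upward closed set of exponents.\<close>

lemma monomial_ideal_iff:
  fixes J :: "('n, 'k::comm_ring_1) polynomial_ring set"
  shows "monomial_ideal J \<longleftrightarrow> is_ideal J \<and> (\<forall>f\<in>J. keys f \<subseteq> exps J)"
proof
  assume "monomial_ideal J"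
  then obtain G where G: "J = ideal_gen (monomial ` G)" by (auto simp: monomial_ideal_def)
  then have J: "is_ideal J" by (simp add: module.subspace_span[OF module_mult])
  have "monomial ` G \<subseteq> {f :: ('n, 'k) polynomial_ring. keys f \<subseteq> exps J}"
    by (auto simp: G exps_def intro: module.span_base[OF module_mult])
  then have "J \<subseteq> {f. keys f \<subseteq> exps J}"
    unfolding G
    by (rule module.span_minimal[OF module_mult])
      (rule keys_subset_is_ideal, use exps_add_left[OF J] in \<open>simp add: G\<close>)
  then show "is_ideal J \<and> (\<forall>f\<in>J. keys f \<subseteq> exps J)" using J by blast
next
  assume J: "is_ideal J \<and> (\<forall>f\<in>J. keys f \<subseteq> exps J)"
  have "ideal_gen (monomial ` exps J) \<subseteq> J"
    using J by (intro module.span_minimal[OF module_mult]) (auto simp: exps_def)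
  moreover have "J \<subseteq> ideal_gen (monomial ` exps J)"
  proof
    fix f assume f: "f \<in> J"
    have "exps J \<subseteq> exps (ideal_gen (monomial ` exps J) :: ('n, 'k) polynomial_ring set)"
      by (auto simp: exps_def intro!: module.span_base[OF module_mult])
    then show "f \<in> ideal_gen (monomial ` exps J)"
      using J f
      by (intro in_ideal_if_keys_subset_exps module.subspace_span[OF module_mult]) blast
  qed
  ultimately show "monomial_ideal J" by (auto simp: monomial_ideal_def)
qed

lemma monomial_ideal_is_ideal: "monomial_ideal J \<Longrightarrow> is_ideal J"
  by (simp add: monomial_ideal_iff)

lemma mem_monomial_ideal_iff: "monomial_ideal J \<Longrightarrow> f \<in> J \<longleftrightarrow> keys f \<subseteq> exps J"
  using in_ideal_if_keys_subset_exps by (auto simp: monomial_ideal_iff)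

text \<open>The Minkowski sum of two upward closed sets of exponents is upward closed, so the polynomials
  supported in it form an ideal, and this ideal contains all products.\<close>

lemma ideal_pow_Suc_subset:
  fixes J :: "('n, 'k::comm_ring_1) polynomial_ring set"
  assumes "monomial_ideal J" "monomial_ideal (ideal_pow J k)"
  shows "ideal_pow J (Suc k) \<subseteq> {f. keys f \<subseteq> {a + b |a b. a \<in> exps J \<and> b \<in> exps (ideal_pow J k)}}"
    (is "_ \<subseteq> {f. keys f \<subseteq> ?E}")
proof -
  have "is_ideal {f :: ('n, 'k) polynomial_ring. keys f \<subseteq> ?E}"
  proof (rule keys_subset_is_ideal)
    fix a b assume "b \<in> ?E"
    then obtain c d where "b = c + d" "c \<in> exps J" "d \<in> exps (ideal_pow J k)" by auto
    then have "a + b = (a + c) + d" "a + c \<in> exps J"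
      using exps_add_left[OF monomial_ideal_is_ideal[OF assms(1)]] by (auto simp: add.assoc)
    then show "a + b \<in> ?E" using \<open>d \<in> _\<close> by blast
  qed
  moreover have "{a * b |a b. a \<in> J \<and> b \<in> ideal_pow J k} \<subseteq> {f. keys f \<subseteq> ?E}"
  proof clarify
    fix f g x assume "f \<in> J" "g \<in> ideal_pow J k" "x \<in> keys (f * g)"
    then show "\<exists>a b. x = a + b \<and> a \<in> exps J \<and> b \<in> exps (ideal_pow J k)"
      using keys_mult[of f g] mem_monomial_ideal_iff[OF assms(1)] mem_monomial_ideal_iff[OF assms(2)]
      by blast
  qed
  ultimately show ?thesis
    by (simp add: module.span_minimal[OF module_mult])
qed

lemma exps_ideal_pow_superset:
  assumes "a \<in> exps J" "b \<in> exps (ideal_pow J k)"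
  shows "a + b \<in> exps (ideal_pow J (Suc k))"
proof -
  have "monomial a * monomial b \<in> ideal_pow J (Suc k)"
    using assms unfolding exps_def
    by (auto simp del: mult_single intro!: module.span_base[OF module_mult])
  then show ?thesis unfolding exps_def by (simp add: mult_single)
qed

lemma monomial_ideal_pow:
  assumes "monomial_ideal J"
  shows "monomial_ideal (ideal_pow J k)"
proof (induction k)
  case 0
  then show ?case by (auto simp: monomial_ideal_iff exps_def ideal_def)
next
  case (Suc k)
  have "keys f \<subseteq> exps (ideal_pow J (Suc k))" if "f \<in> ideal_pow J (Suc k)" for f
    using ideal_pow_Suc_subset[OF assms Suc] that exps_ideal_pow_superset[of _ J _ k] by blast
  then show ?case using ideal_pow_is_ideal[of J "Suc k"] by (auto simp: monomial_ideal_iff)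
qed

lemma exps_ideal_pow_Suc:
  fixes J :: "('n, 'k::comm_ring_1) polynomial_ring set"
  assumes "monomial_ideal J"
  shows "exps (ideal_pow J (Suc k)) = {a + b |a b. a \<in> exps J \<and> b \<in> exps (ideal_pow J k)}" (is "_ = ?E")
proof
  show "?E \<subseteq> exps (ideal_pow J (Suc k))" using exps_ideal_pow_superset by blast
  show "exps (ideal_pow J (Suc k)) \<subseteq> ?E"
  proof
    fix a assume "a \<in> exps (ideal_pow J (Suc k))"
    then have "keys (monomial a :: ('n, 'k) polynomial_ring) \<subseteq> ?E"
      using ideal_pow_Suc_subset[OF assms monomial_ideal_pow[OF assms], of k]
      unfolding exps_def by blast
    then show "a \<in> ?E" by simp
  qed
qed

lemma exps_ideal_pow_0: "exps (ideal_pow J 0) = UNIV"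
  by (simp add: exps_def)

section \<open>Exponents that survive in a product\<close>

text \<open>If \<open>a + b\<close> arises in only one way from exponents of the two factors, then nothing can cancel
  the product of the two terms.\<close>

lemma key_of_product:
  fixes f g :: "('a::{comm_monoid_add,cancel_ab_semigroup_add}) \<Rightarrow>\<^sub>0 'k::idom"
  assumes a: "a \<in> keys f" and b: "b \<in> keys g"
    and uniq: "\<And>a' b'. a' \<in> keys f \<Longrightarrow> b' \<in> keys g \<Longrightarrow> a' + b' = a + b \<Longrightarrow> a' = a"
  shows "a + b \<in> keys (f * g)"
proof -
  define f' where "f' = f - Poly_Mapping.single a (lookup f a)"
  define g' where "g' = g - Poly_Mapping.single b (lookup g b)"
  have k: "keys f' = keys f - {a}" "keys g' = keys g - {b}"
    unfolding f'_def g'_def by (rule keys_remove_term)+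
  have "f * g = Poly_Mapping.single (a + b) (lookup f a * lookup g b)
      + (Poly_Mapping.single a (lookup f a) * g' + f' * g)"
    unfolding f'_def g'_def by (simp add: algebra_simps mult_single)
  moreover have "a + b \<notin> keys (f' * g)"
    using keys_mult[of f' g] uniq by (force simp: k)
  moreover have "a + b \<notin> keys (Poly_Mapping.single a (lookup f a) * g')"
    using keys_mult[of "Poly_Mapping.single a (lookup f a)" g'] by (auto simp: k split: if_splits)
  ultimately have "lookup (f * g) (a + b) = lookup f a * lookup g b"
    by (simp add: lookup_add in_keys_iff)
  then show ?thesis using a b by (simp add: in_keys_iff)
qed

text \<open>The order of the exponents plays the role of a monomial order, and \<open>Max (keys f)\<close> that of the
  leading exponent.\<close>

lemma Max_keys_mult:
  fixes f g :: "('a::{ordered_cancel_comm_monoid_add,linorder}) \<Rightarrow>\<^sub>0 'k::idom"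
  assumes "f \<noteq> 0" "g \<noteq> 0"
  shows "Max (keys (f * g)) = Max (keys f) + Max (keys g)"
proof (rule Max_eqI)
  let ?a = "Max (keys f)" and ?b = "Max (keys g)"
  have ne: "keys f \<noteq> {}" "keys g \<noteq> {}" using assms by simp_all
  show "finite (keys (f * g))" by simp
  show "y \<le> ?a + ?b" if y: "y \<in> keys (f * g)" for y
  proof -
    obtain c d where "y = c + d" "c \<in> keys f" "d \<in> keys g" using y keys_mult[of f g] by blast
    then show ?thesis by (auto intro!: add_mono)
  qed
  show "?a + ?b \<in> keys (f * g)"
  proof (rule key_of_product)
    show "?a \<in> keys f" "?b \<in> keys g" using ne by simp_all
    fix c d assume cd: "c \<in> keys f" "d \<in> keys g" "c + d = ?a + ?b"
    then have "c \<le> ?a" "d \<le> ?b" by simp_all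
    show "c = ?a"
    proof (rule ccontr)
      assume "c \<noteq> ?a"
      then have "c + d < ?a + ?b"
        using \<open>c \<le> ?a\<close> \<open>d \<le> ?b\<close> by (intro add_less_le_mono) auto
      then show False using cd by simp
    qed
  qed
qed

text \<open>For a monomial prime, the weight of interest is the degree in its variables, which is \<open>0\<close> exactly
  for the monomials outside the prime. Among the exponents of \<open>f\<close> of least weight and those of \<open>g\<close>
  of weight \<open>0\<close>, the leading ones have a sum that arises in no other way.\<close>

lemma key_of_product_min_weight:
  fixes f g :: "('a::{ordered_cancel_comm_monoid_add,linorder}) \<Rightarrow>\<^sub>0 'k::idom" and w :: "'a \<Rightarrow> nat"
  assumes "f \<noteq> 0" and w: "\<And>a b. w (a + b) = w a + w b"
    and g: "b0 \<in> keys g" "w b0 = 0"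
  obtains a b where "a \<in> keys f" "b \<in> keys g" "w b = 0" "a + b \<in> keys (f * g)"
proof -
  define F where "F = {a \<in> keys f. w a = Min (w ` keys f)}"
  define G where "G = {b \<in> keys g. w b = 0}"
  have fin: "finite F" "finite G" by (auto simp: F_def G_def)
  have "Min (w ` keys f) \<in> w ` keys f" using assms(1) by (intro Min_in) auto
  then have ne: "F \<noteq> {}" "G \<noteq> {}" using g by (auto simp: F_def G_def)
  have M: "Max F \<in> F" "Max G \<in> G" using fin ne by simp_all
  show ?thesis
  proof (rule that[of "Max F" "Max G"])
    show "Max F \<in> keys f" "Max G \<in> keys g" "w (Max G) = 0" using M by (auto simp: F_def G_def)
    show "Max F + Max G \<in> keys (f * g)"
    proof (rule key_of_product)
      show "Max F \<in> keys f" "Max G \<in> keys g" using M by (auto simp: F_def G_def)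
      fix c d assume cd: "c \<in> keys f" "d \<in> keys g" "c + d = Max F + Max G"
      then have "w c + w d = w (Max F)" using M w by (metis (mono_tags, lifting) G_def add.right_neutral mem_Collect_eq)
      moreover have "w (Max F) = Min (w ` keys f)" using M(1) by (simp add: F_def)
      moreover have "Min (w ` keys f) \<le> w c" using cd(1) by simp
      ultimately have "w c = Min (w ` keys f)" "w d = 0" by linarith+
      then have "c \<in> F" "d \<in> G" using cd by (auto simp: F_def G_def)
      then have "c \<le> Max F" "d \<le> Max G" using fin by auto
      show "c = Max F"
      proof (rule ccontr)
        assume "c \<noteq> Max F"
        then have "c + d < Max F + Max G"
          using \<open>c \<le> Max F\<close> \<open>d \<le> Max G\<close> by (intro add_less_le_mono) auto
        then show False using cd by simp
      qed
    qed
  qed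
qed

section \<open>Prime and primary ideals\<close>

lemma prime_ideal_is_ideal: "prime_ideal P \<Longrightarrow> is_ideal P"
  by (simp add: prime_ideal_def)

lemma primary_ideal_is_ideal: "primary_ideal Q \<Longrightarrow> is_ideal Q"
  by (simp add: primary_ideal_def)

lemma one_notin_proper_ideal: "is_ideal J \<Longrightarrow> J \<noteq> UNIV \<Longrightarrow> 1 \<notin> J"
  using ideal_closed(4)[of J 1] by fastforce

lemma prime_ideal_mult_iff: "prime_ideal P \<Longrightarrow> a * b \<in> P \<longleftrightarrow> a \<in> P \<or> b \<in> P"
  using ideal_closed(4,5)[of P] by (auto simp: prime_ideal_def)

lemma one_notin_prime_ideal: "prime_ideal P \<Longrightarrow> 1 \<notin> P"
  by (simp add: prime_ideal_def one_notin_proper_ideal)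

lemma prime_ideal_prod:
  assumes "prime_ideal P" "finite F" "prod f F \<in> P"
  shows "\<exists>i\<in>F. f i \<in> P"
  using assms(2,3,1) one_notin_prime_ideal[OF assms(1)]
  by (induction F rule: finite_induct) (auto simp: prime_ideal_mult_iff)

lemma prime_ideal_power: "prime_ideal P \<Longrightarrow> a ^ m \<in> P \<Longrightarrow> a \<in> P"
  by (induction m) (auto simp: prime_ideal_mult_iff one_notin_prime_ideal)

lemma subset_ideal_radical: "Q \<subseteq> ideal_radical Q"
  unfolding ideal_radical_def by clarify (metis power_one_right)

lemma ideal_radical_subset_prime: "prime_ideal P \<Longrightarrow> Q \<subseteq> P \<Longrightarrow> ideal_radical Q \<subseteq> P"
  unfolding ideal_radical_def using prime_ideal_power by blast

lemma is_ideal_radical: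
  assumes Q: "is_ideal Q"
  shows "is_ideal (ideal_radical Q)"
  unfolding ideal_def
proof (intro conjI ballI allI)
  show "0 \<in> ideal_radical Q"
    using subset_ideal_radical ideal_closed(1)[OF Q] by blast
next
  fix a b assume "a \<in> ideal_radical Q" "b \<in> ideal_radical Q"
  then obtain m n where mn: "a ^ m \<in> Q" "b ^ n \<in> Q" by (auto simp: ideal_radical_def)
  have "of_nat ((m + n) choose k) * a ^ k * b ^ (m + n - k) \<in> Q" for k
  proof (cases "m \<le> k")
    case True
    then have "a ^ k = a ^ m * a ^ (k - m)" by (simp flip: power_add)
    then show ?thesis using mn ideal_closed(4,5)[OF Q] by simp
  next
    case False
    then have "b ^ (m + n - k) = b ^ n * b ^ (m - k)" by (simp add: add.commute flip: power_add)
    then show ?thesis using mn ideal_closed(4,5)[OF Q] by simp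
  qed
  then have "(a + b) ^ (m + n) \<in> Q"
    unfolding binomial_ring by (intro ideal_closed(7)[OF Q])
  then show "a + b \<in> ideal_radical Q" by (auto simp: ideal_radical_def)
next
  fix c a assume "a \<in> ideal_radical Q"
  then obtain m where "a ^ m \<in> Q" by (auto simp: ideal_radical_def)
  then have "(c * a) ^ m \<in> Q" using ideal_closed(4)[OF Q] by (simp add: power_mult_distrib)
  then show "c * a \<in> ideal_radical Q" by (auto simp: ideal_radical_def)
qed

lemma prime_ideal_radical:
  assumes Q: "primary_ideal Q"
  shows "prime_ideal (ideal_radical Q)"
  unfolding prime_ideal_def
proof (intro conjI allI impI)
  have iQ: "is_ideal Q" by (rule primary_ideal_is_ideal[OF Q])
  then show "is_ideal (ideal_radical Q)" by (rule is_ideal_radical)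
  have "1 \<notin> Q" using Q iQ one_notin_proper_ideal by (auto simp: primary_ideal_def)
  then have "1 \<notin> ideal_radical Q" by (simp add: ideal_radical_def)
  then show "ideal_radical Q \<noteq> UNIV" by blast
next
  fix a b assume "a * b \<in> ideal_radical Q"
  then obtain m where "a ^ m * b ^ m \<in> Q" by (auto simp: ideal_radical_def power_mult_distrib)
  then have "a ^ m \<in> Q \<or> b ^ m \<in> ideal_radical Q" using Q by (auto simp: primary_ideal_def)
  then show "a \<in> ideal_radical Q \<or> b \<in> ideal_radical Q"
    unfolding ideal_radical_def by (auto simp flip: power_mult)
qed

lemma primary_cancel:
  assumes "primary_ideal Q" "s * a \<in> Q" "s \<notin> ideal_radical Q"
  shows "a \<in> Q"
  using assms unfolding primary_ideal_def by (metis mult.commute)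

lemma is_ideal_colon:
  assumes "is_ideal J"
  shows "is_ideal {q. q * g \<in> J}"
  using ideal_closed[OF assms] by (auto simp: ideal_def algebra_simps) (metis mult.assoc mult.commute)

section \<open>Radicals of primary components of monomial ideals\<close>

text \<open>The sum is the \<open>m\<close>-fold multiple of the exponent \<open>a\<close>.\<close>

lemma monomial_power: "monomial a ^ m = monomial (\<Sum>i<m. a)"
  by (induction m) (simp_all add: mult_single add.commute)

lemma Max_keys_power:
  fixes p :: "('a::{ordered_cancel_comm_monoid_add,linorder}) \<Rightarrow>\<^sub>0 'k::idom"
  assumes "p \<noteq> 0"
  shows "Max (keys (p ^ m)) = (\<Sum>i<m. Max (keys p))"
  using assms by (induction m) (simp_all add: Max_keys_mult add.commute)

text \<open>The assumptions give \<open>(I : f) = (Q : f)\<close>. Let \<open>x^a\<close> be the leading monomial of \<open>p\<close>, and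
  suppose that it is not in the radical. Some \<open>p^m f\<close> lies in the monomial ideal \<open>I\<close>, so its leading
  monomial lies there too. Hence, modulo \<open>I\<close>, multiplying \<open>f\<close> by \<open>x^(m a)\<close> kills the leading term of
  \<open>f\<close>, while \<open>x^(m a)\<close> can be cancelled modulo \<open>Q\<close>. So \<open>x^(m a)\<close> times the other terms of \<open>f\<close> has the
  same property as \<open>f\<close>, with fewer terms, and this cannot go on forever.\<close>

lemma leading_monomial_in_radical:
  fixes f p :: "('n::linorder, 'k::field) polynomial_ring"
  assumes I: "monomial_ideal I" and Q: "primary_ideal Q" and "I \<subseteq> Q"
    and "f \<notin> Q" "\<And>g. g * f \<in> Q \<Longrightarrow> g * f \<in> I"
    and p: "p \<in> ideal_radical Q" "p \<noteq> 0"
  shows "monomial (Max (keys p)) \<in> ideal_radical Q"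
  using assms(4,5)
proof (induction "card (keys f)" arbitrary: f rule: less_induct)
  case less
  have iQ: "is_ideal Q" by (rule primary_ideal_is_ideal[OF Q])
  obtain m where m: "p ^ m \<in> Q" using p by (auto simp: ideal_radical_def)
  have f0: "f \<noteq> 0" using less.prems ideal_closed(1)[OF iQ] by blast
  define c where "c = Max (keys f)"
  define a where "a = Max (keys p)"
  define f1 where "f1 = f - Poly_Mapping.single c (lookup f c)"
  have c: "c \<in> keys f" unfolding c_def using f0 by simp
  have "p ^ m * f \<in> I" using less.prems m ideal_closed(5)[OF iQ] by blast
  moreover have "Max (keys (p ^ m * f)) = (\<Sum>i<m. a) + c"
    using p f0 by (simp add: Max_keys_mult Max_keys_power a_def c_def)
  moreover have "Max (keys (p ^ m * f)) \<in> keys (p ^ m * f)" using p f0 by simp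
  ultimately have "(\<Sum>i<m. a) + c \<in> exps I"
    unfolding mem_monomial_ideal_iff[OF I] by (metis subsetD)
  then have ac: "monomial (\<Sum>i<m. a) * monomial c \<in> I"
    by (simp only: exps_def monomial_add mem_Collect_eq)
  have "monomial (\<Sum>i<m. a) * Poly_Mapping.single c (lookup f c)
      = Poly_Mapping.single 0 (lookup f c) * (monomial (\<Sum>i<m. a) * monomial c)"
    by (simp add: mult_single)
  then have lead: "monomial (\<Sum>i<m. a) * Poly_Mapping.single c (lookup f c) \<in> I"
    using ac ideal_closed(4)[OF monomial_ideal_is_ideal[OF I]] by metis
  define f2 where "f2 = monomial (\<Sum>i<m. a) * f1"
  have f2: "f2 = monomial (\<Sum>i<m. a) * f - monomial (\<Sum>i<m. a) * Poly_Mapping.single c (lookup f c)"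
    by (simp add: f2_def f1_def algebra_simps)
  show ?case
  proof (rule ccontr)
    assume "monomial (Max (keys p)) \<notin> ideal_radical Q"
    then have nm: "monomial (\<Sum>i<m. a) \<notin> ideal_radical Q"
      using prime_ideal_power[OF prime_ideal_radical[OF Q]] by (metis a_def monomial_power)
    have "keys f2 \<subseteq> (\<lambda>x. (\<Sum>i<m. a) + x) ` keys f1"
      using keys_mult[of "monomial (\<Sum>i<m. a)" f1] by (auto simp: f2_def)
    then have "card (keys f2) \<le> card (keys f1)" by (rule surj_card_le[rotated]) simp
    moreover have "keys f1 = keys f - {c}" unfolding f1_def by (rule keys_remove_term)
    ultimately have "card (keys f2) < card (keys f)"
      using c by (metis card_Diff1_less finite_keys le_less_trans)
    moreover have "f2 \<notin> Q"
    proof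
      assume "f2 \<in> Q"
      then have "f2 + monomial (\<Sum>i<m. a) * Poly_Mapping.single c (lookup f c) \<in> Q"
        using lead \<open>I \<subseteq> Q\<close> ideal_closed(2)[OF iQ] by blast
      then have "monomial (\<Sum>i<m. a) * f \<in> Q" by (simp add: f2)
      then show False using primary_cancel[OF Q _ nm] less.prems by blast
    qed
    moreover have "g * f2 \<in> I" if "g * f2 \<in> Q" for g
    proof -
      have e: "g * f2 = (g * monomial (\<Sum>i<m. a)) * f
          - g * (monomial (\<Sum>i<m. a) * Poly_Mapping.single c (lookup f c))"
        unfolding f2 by (simp add: algebra_simps)
      have l: "g * (monomial (\<Sum>i<m. a) * Poly_Mapping.single c (lookup f c)) \<in> I"
        using lead ideal_closed(4)[OF monomial_ideal_is_ideal[OF I]] by blast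
      have "g * f2 + g * (monomial (\<Sum>i<m. a) * Poly_Mapping.single c (lookup f c)) \<in> Q"
        using that l \<open>I \<subseteq> Q\<close> ideal_closed(2)[OF iQ] by blast
      then have "(g * monomial (\<Sum>i<m. a)) * f \<in> Q" by (simp add: e)
      then have "(g * monomial (\<Sum>i<m. a)) * f \<in> I" by (rule less.prems)
      then show ?thesis
        unfolding e using l ideal_closed(3)[OF monomial_ideal_is_ideal[OF I]] by blast
    qed
    ultimately show False
      using less.hyps \<open>monomial (Max (keys p)) \<notin> ideal_radical Q\<close> by blast
  qed
qed

text \<open>The leading term of an element of the radical can be subtracted within the radical. This makes
  the radical of a primary component monomial before anything is known about the component itself.\<close>

lemma monomial_ideal_radical:
  fixes f :: "('n::linorder, 'k::field) polynomial_ring"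
  assumes I: "monomial_ideal I" and Q: "primary_ideal Q" and "I \<subseteq> Q"
    and "f \<notin> Q" "\<And>g. g * f \<in> Q \<Longrightarrow> g * f \<in> I"
  shows "monomial_ideal (ideal_radical Q)"
proof -
  have iP: "is_ideal (ideal_radical Q)" by (rule is_ideal_radical[OF primary_ideal_is_ideal[OF Q]])
  have "keys p \<subseteq> exps (ideal_radical Q)" if "p \<in> ideal_radical Q" for p
    using that
  proof (induction "card (keys p)" arbitrary: p rule: less_induct)
    case less
    show ?case
    proof (cases "p = 0")
      case False
      define a where "a = Max (keys p)"
      have a: "a \<in> keys p" unfolding a_def using False by simp
      have aP: "monomial a \<in> ideal_radical Q"
        unfolding a_def by (rule leading_monomial_in_radical[OF assms less.prems False])
      define p1 where "p1 = p - Poly_Mapping.single a (lookup p a)"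
      have k: "keys p1 = keys p - {a}" unfolding p1_def by (rule keys_remove_term)
      have "Poly_Mapping.single a (lookup p a) \<in> ideal_radical Q"
        using aP ideal_closed(4)[OF iP] by (subst single_eq_scaled_monomial)
      then have "p1 \<in> ideal_radical Q"
        unfolding p1_def using less.prems ideal_closed(3)[OF iP] by blast
      moreover have "card (keys p1) < card (keys p)" unfolding k using a by (intro card_Diff1_less) auto
      ultimately have "keys p1 \<subseteq> exps (ideal_radical Q)" using less.hyps by blast
      then show ?thesis using aP unfolding k by (auto simp: exps_def)
    qed simp
  qed
  then show ?thesis using iP by (auto simp: monomial_ideal_iff)
qed

text \<open>Multiplying repeatedly by one element of the radical ends up in \<open>Q\<close>; the last multiple outside
  \<open>Q\<close> is killed by that element. For a finite set this is done one element after the other. This finds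
  a socle element, and so an associated prime, without chain conditions.\<close>

lemma ex_multiple_killed_by_radical_elements:
  assumes Q: "is_ideal Q" and "finite A" "A \<subseteq> ideal_radical Q" "f \<notin> Q"
  shows "\<exists>h. h * f \<notin> Q \<and> (\<forall>x\<in>A. x * (h * f) \<in> Q)"
  using assms(2,3)
proof (induction A rule: finite_induct)
  case empty
  then show ?case using assms(4) by (intro exI[of _ 1]) simp
next
  case (insert x A)
  then obtain h where h: "h * f \<notin> Q" "\<forall>y\<in>A. y * (h * f) \<in> Q" by auto
  obtain N where "x ^ N \<in> Q" using insert.prems by (auto simp: ideal_radical_def)
  then have N: "x ^ N * (h * f) \<in> Q" using ideal_closed(5)[OF Q] by blast
  define n where "n = (LEAST n. x ^ n * (h * f) \<in> Q)"
  have n: "x ^ n * (h * f) \<in> Q" unfolding n_def using N by (rule LeastI)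
  then have "n \<noteq> 0" using h by (metis mult_1 power_0)
  then obtain k where k: "n = Suc k" by (cases n) auto
  have "x ^ k * (h * f) \<notin> Q" using not_less_Least[of k "\<lambda>n. x ^ n * (h * f) \<in> Q"] k
    unfolding n_def by simp
  moreover have "x * (x ^ k * (h * f)) \<in> Q" using n k by (simp add: mult.assoc)
  moreover have "y * (x ^ k * (h * f)) \<in> Q" if "y \<in> A" for y
  proof -
    have "x ^ k * (y * (h * f)) \<in> Q" using that h ideal_closed(4)[OF Q] by blast
    then show ?thesis by (simp add: algebra_simps)
  qed
  ultimately show ?case
    by (intro exI[of _ "x ^ k * h"]) (simp add: mult.assoc)
qed

lemma exponent_remove_variable:
  fixes a :: "'n \<Rightarrow>\<^sub>0 nat"
  assumes "l \<in> keys a"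
  shows "a = Poly_Mapping.single l 1 + (a - Poly_Mapping.single l 1)"
  using assms by (intro poly_mapping_eqI) (auto simp: lookup_add lookup_minus lookup_single when_def in_keys_iff)

text \<open>A monomial is a product of variables, and a prime ideal that contains a product
  contains one of the factors.\<close>

lemma exps_prime_ideal_iff:
  fixes P :: "('n::finite, 'k::comm_ring_1) polynomial_ring set"
  assumes P: "prime_ideal P"
  shows "a \<in> exps P \<longleftrightarrow> (\<exists>l\<in>keys a. monomial (Poly_Mapping.single l 1) \<in> P)"
proof
  assume "a \<in> exps P"
  then show "\<exists>l\<in>keys a. monomial (Poly_Mapping.single l 1) \<in> P"
  proof (induction "\<Sum>l\<in>UNIV. lookup a l" arbitrary: a rule: less_induct)
    case less
    have "a \<noteq> 0" using less.prems one_notin_prime_ideal[OF P] by (auto simp: exps_def)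
    then obtain l where l: "l \<in> keys a" by fastforce
    define b where "b = a - Poly_Mapping.single l 1"
    have ab: "a = Poly_Mapping.single l 1 + b" unfolding b_def by (rule exponent_remove_variable[OF l])
    have "monomial (Poly_Mapping.single l 1) * monomial b \<in> P"
      using less.prems ab by (simp add: exps_def mult_single)
    then consider "monomial (Poly_Mapping.single l 1) \<in> P" | "b \<in> exps P"
      using prime_ideal_mult_iff[OF P] by (auto simp: exps_def)
    then show ?case
    proof cases
      case 2
      have "(\<Sum>l\<in>UNIV. lookup b l) < (\<Sum>l\<in>UNIV. lookup a l)"
        by (rule sum_strict_mono_ex1) (use l in \<open>auto simp: ab lookup_add lookup_single intro!: exI[of _ l]\<close>)
      moreover have "keys b \<subseteq> keys a" by (auto simp: ab in_keys_iff lookup_add)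
      ultimately show ?thesis using less.hyps 2 by blast
    qed (use l in blast)
  qed
next
  assume "\<exists>l\<in>keys a. monomial (Poly_Mapping.single l 1) \<in> P"
  then show "a \<in> exps P"
    using exps_add_right[OF prime_ideal_is_ideal[OF P]] exponent_remove_variable
    by (metis exps_def mem_Collect_eq)
qed

section \<open>Powers of primary monomial ideals\<close>

text \<open>Riesz refinement; \<open>c - (c - a)\<close> is the truncated subtraction for the pointwise minimum of \<open>a\<close> and \<open>c\<close>.\<close>

lemma exponent_refinement:
  fixes a b c d :: "'n \<Rightarrow>\<^sub>0 nat"
  assumes "a + b = c + d"
  obtains c1 c2 d1 d2 where "c = c1 + c2" "d = d1 + d2" "a = c1 + d1" "b = c2 + d2"
proof -
  have e: "lookup a i + lookup b i = lookup c i + lookup d i" for i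
    using assms by (metis lookup_add)
  show ?thesis
  proof (rule that[of "c - (c - a)" "c - a" "a - c" "b - (c - a)"])
    show "c = c - (c - a) + (c - a)" "a = c - (c - a) + (a - c)"
      by (intro poly_mapping_eqI; simp add: lookup_add lookup_minus)+
    show "d = a - c + (b - (c - a))"
    proof (rule poly_mapping_eqI)
      fix i show "lookup d i = lookup (a - c + (b - (c - a))) i"
        using e[of i] unfolding lookup_add lookup_minus by arith
    qed
    show "b = c - a + (b - (c - a))"
    proof (rule poly_mapping_eqI)
      fix i show "lookup b i = lookup (c - a + (b - (c - a))) i"
        using e[of i] unfolding lookup_add lookup_minus by arith
    qed
  qed
qed

text \<open>Powers of a primary ideal need not be primary, but those of a primary monomial ideal are: the
  minimal generators of the ideal involve only variables of its radical, so divisibility by products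
  of them is not affected by the removal of a monomial in the other variables. The refinement property expresses this without generators.\<close>

lemma exps_pow_cancel:
  fixes Q :: "('n, 'k::comm_ring_1) polynomial_ring set"
  assumes Q: "primary_ideal Q" "monomial_ideal Q"
    and "a + b \<in> exps (ideal_pow Q k)" "b \<notin> exps (ideal_radical Q)"
  shows "a \<in> exps (ideal_pow Q k)"
  using assms(3,4)
proof (induction k arbitrary: a b)
  case 0
  show ?case unfolding exps_ideal_pow_0 by simp
next
  case (Suc k)
  obtain c d where cd: "a + b = c + d" "c \<in> exps Q" "d \<in> exps (ideal_pow Q k)"
    using Suc.prems unfolding exps_ideal_pow_Suc[OF Q(2)] by blast
  obtain c1 c2 d1 d2 where r: "c = c1 + c2" "d = d1 + d2" "a = c1 + d1" "b = c2 + d2"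
    using exponent_refinement[OF cd(1)] .
  have iP: "is_ideal (ideal_radical Q)" by (rule is_ideal_radical[OF monomial_ideal_is_ideal[OF Q(2)]])
  have n: "c2 \<notin> exps (ideal_radical Q)" "d2 \<notin> exps (ideal_radical Q)"
    using Suc.prems(2) exps_add_left[OF iP] exps_add_right[OF iP] unfolding r by blast+
  have "monomial c2 * monomial c1 \<in> Q"
    using cd(2) r by (simp add: exps_def mult_single add.commute)
  then have "c1 \<in> exps Q"
    using primary_cancel[OF Q(1)] n(1) by (simp add: exps_def del: mult_single)
  moreover have "d1 \<in> exps (ideal_pow Q k)" using Suc.IH[of d1 d2] cd(3) r(2) n(2) by blast
  ultimately show ?case unfolding r using exps_ideal_pow_superset by blast
qed

text \<open>The previous lemma allows the cancellation of monomials, this one that of polynomials. Terms of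
  \<open>f\<close> that lie in the power can be subtracted, so \<open>f\<close> may be assumed to have none. The weight is the degree
  in the variables of the radical, and a term of \<open>f * s\<close> that survives yields a monomial to which the
  previous lemma applies.\<close>

lemma ideal_pow_cancel:
  fixes Q :: "('n::{finite,linorder}, 'k::field) polynomial_ring set"
  assumes Q: "primary_ideal Q" "monomial_ideal Q" and P: "monomial_ideal (ideal_radical Q)"
    and "f * s \<in> ideal_pow Q k" and s: "s \<notin> ideal_radical Q"
  shows "f \<in> ideal_pow Q k"
  using assms(4)
proof (induction "card (keys f)" arbitrary: f rule: less_induct)
  case less
  let ?J = "ideal_pow Q k" and ?P = "ideal_radical Q"
  have J: "monomial_ideal ?J" by (rule monomial_ideal_pow[OF Q(2)])
  note iJ = ideal_closed[OF monomial_ideal_is_ideal[OF J]]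
  have prime: "prime_ideal ?P" by (rule prime_ideal_radical[OF Q(1)])
  show ?case
  proof (cases "keys f \<inter> exps ?J = {}")
    case False
    then obtain a where a: "a \<in> keys f" "a \<in> exps ?J" by blast
    define t where "t = Poly_Mapping.single a (lookup f a)"
    have t: "t \<in> ?J"
      using a(2) iJ(4) unfolding t_def by (subst single_eq_scaled_monomial) (simp add: exps_def del: mult_single)
    have "card (keys (f - t)) < card (keys f)"
      unfolding t_def keys_remove_term using a(1) by (intro card_Diff1_less) auto
    moreover have "(f - t) * s \<in> ?J"
      using less.prems iJ(3)[of "f * s" "t * s"] iJ(5)[OF t, of s] by (simp add: algebra_simps)
    ultimately have "f - t \<in> ?J" using less.hyps by blast
    then have "f - t + t \<in> ?J" using t iJ(2) by blast
    then show ?thesis by simp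
  next
    case True
    show ?thesis
    proof (cases "f = 0")
      case True
      then show ?thesis using iJ(1) by simp
    next
      case False
      define w :: "('n \<Rightarrow>\<^sub>0 nat) \<Rightarrow> nat" where "w b = (\<Sum>l | monomial (Poly_Mapping.single l 1) \<in> ?P. lookup b l)" for b
      have w0: "w b = 0 \<longleftrightarrow> b \<notin> exps ?P" for b
        unfolding exps_prime_ideal_iff[OF prime] w_def by (auto simp: in_keys_iff)
      obtain b0 where b0: "b0 \<in> keys s" "w b0 = 0"
        using s unfolding mem_monomial_ideal_iff[OF P] w0 by blast
      have "w (a + b) = w a + w b" for a b by (simp add: w_def lookup_add sum.distrib)
      from key_of_product_min_weight[of f w, OF False this b0]
      obtain a b where ab: "a \<in> keys f" "w b = 0" "a + b \<in> keys (f * s)" by blast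
      then have "a + b \<in> exps ?J" using less.prems mem_monomial_ideal_iff[OF J] by blast
      then have "a \<in> exps ?J" using exps_pow_cancel[OF Q] ab(2) w0 by blast
      then show ?thesis using ab(1) True by blast
    qed
  qed
qed

section \<open>Symbolic powers\<close>

lemma power_times_ideal_pow:
  assumes "\<And>q. q \<in> Q \<Longrightarrow> s * q \<in> I" and "q \<in> ideal_pow Q k"
  shows "s ^ k * q \<in> ideal_pow I k"
  using assms(2)
proof (induction k arbitrary: q)
  case (Suc k)
  have "{a * b |a b. a \<in> Q \<and> b \<in> ideal_pow Q k} \<subseteq> {q. q * s ^ Suc k \<in> ideal_pow I (Suc k)}"
  proof clarify
    fix a b assume ab: "a \<in> Q" "b \<in> ideal_pow Q k"
    have "(s * a) * (s ^ k * b) \<in> ideal_pow I (Suc k)"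
      using assms(1)[OF ab(1)] Suc.IH[OF ab(2)] by (auto intro!: module.span_base[OF module_mult])
    moreover have "(s * a) * (s ^ k * b) = a * b * s ^ Suc k" by (simp add: algebra_simps)
    ultimately show "a * b * s ^ Suc k \<in> ideal_pow I (Suc k)" by metis
  qed
  then have "ideal_pow Q (Suc k) \<subseteq> {q. q * s ^ Suc k \<in> ideal_pow I (Suc k)}"
    using is_ideal_colon[OF ideal_pow_is_ideal[of I "Suc k"], of "s ^ Suc k"]
    by (subst ideal_pow.simps(2)) (rule module.span_minimal[OF module_mult])
  then show ?case using Suc.prems by (auto simp: mult.commute)
qed simp

text \<open>The usual common denominator argument.\<close>

lemma to_fract_in_extended_ideal_iff:
  assumes J: "is_ideal J" and P: "prime_ideal P"
  shows "to_fract f \<in> extended_ideal J P \<longleftrightarrow> (\<exists>s. s \<notin> P \<and> s * f \<in> J)"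
proof
  have P0: "s \<noteq> 0" if "s \<notin> P" for s
    using that ideal_closed(1)[OF prime_ideal_is_ideal[OF P]] by blast
  {
    assume "to_fract f \<in> extended_ideal J P"
    then obtain F c where F: "finite F" "F \<subseteq> J" "\<forall>a\<in>F. c a \<in> localization P"
        and f: "to_fract f = (\<Sum>a\<in>F. c a * to_fract a)"
      unfolding extended_ideal_def by blast
    have "\<exists>s g. s \<notin> P \<and> g \<in> J \<and> (\<Sum>a\<in>F. c a * to_fract a) = Fract g s"
      using F
    proof (induction F rule: finite_induct)
      case empty
      then show ?case
        using one_notin_prime_ideal[OF P] ideal_closed(1)[OF J] by (auto simp: Zero_fract_def)
    next
      case (insert x F)
      then obtain s g where sg: "s \<notin> P" "g \<in> J" "(\<Sum>a\<in>F. c a * to_fract a) = Fract g s" by auto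
      obtain d t where dt: "c x = Fract d t" "t \<notin> P" using insert.prems by (auto simp: localization_def)
      have "(\<Sum>a\<in>insert x F. c a * to_fract a) = Fract (d * x) t + Fract g s"
        using insert.hyps sg dt by simp
      also have "\<dots> = Fract (d * x * s + g * t) (t * s)"
        using P0 sg dt by simp
      finally have "(\<Sum>a\<in>insert x F. c a * to_fract a) = Fract (d * x * s + g * t) (t * s)" .
      moreover have "t * s \<notin> P" using sg dt prime_ideal_mult_iff[OF P] by blast
      moreover have "d * x * s + g * t \<in> J"
        using sg(2) insert.prems
        by (intro ideal_closed(2)[OF J] ideal_closed(5)[OF J] ideal_closed(4)[OF J]) auto
      ultimately show ?case by blast
    qed
    then obtain s g where sg: "s \<notin> P" "g \<in> J" "to_fract f = Fract g s" using f by auto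
    then have "s * f = g" using P0[OF sg(1)] by (simp add: eq_fract mult.commute)
    then show "\<exists>s. s \<notin> P \<and> s * f \<in> J" using sg by blast
  }
  assume "\<exists>s. s \<notin> P \<and> s * f \<in> J"
  then obtain s where s: "s \<notin> P" "s * f \<in> J" by blast
  then have "to_fract f = (\<Sum>a\<in>{s * f}. Fract 1 s * to_fract a)"
    using P0 by (simp add: eq_fract)
  moreover have "Fract 1 s \<in> localization P" using s by (auto simp: localization_def)
  ultimately show "to_fract f \<in> extended_ideal J P"
    using s unfolding extended_ideal_def by (intro CollectI exI[of _ "{s * f}"] exI[of _ "\<lambda>_. Fract 1 s"]) auto
qed

locale unmixed_monomial_decomposition =
  fixes I :: "('n::{finite,linorder}, 'k::field) polynomial_ring set"
    and Q :: "nat \<Rightarrow> ('n, 'k) polynomial_ring set" and r :: nat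
  assumes monomial_I: "monomial_ideal I"
    and unmixed: "embedded_primes I = {}"
    and decomposition: "minimal_primary_decomposition I r Q"
begin

lemma I_eq: "I = (\<Inter>i\<in>{1..r}. Q i)"
  and primary: "i \<in> {1..r} \<Longrightarrow> primary_ideal (Q i)"
  and radical_inj: "inj_on (\<lambda>i. ideal_radical (Q i)) {1..r}"
  and irredundant: "i \<in> {1..r} \<Longrightarrow> (\<Inter>j\<in>{1..r} - {i}. Q j) \<noteq> I"
  using decomposition unfolding minimal_primary_decomposition_def by blast+

lemma is_ideal_Q: "i \<in> {1..r} \<Longrightarrow> is_ideal (Q i)"
  by (simp add: primary primary_ideal_is_ideal)

lemma prime_radical: "i \<in> {1..r} \<Longrightarrow> prime_ideal (ideal_radical (Q i))"
  by (simp add: primary prime_ideal_radical)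

lemma I_subset: "i \<in> {1..r} \<Longrightarrow> I \<subseteq> Q i"
  using I_eq by blast

text \<open>By irredundancy some \<open>f\<close> outside \<open>Q i\<close> lies in all other components. For such \<open>f\<close> the colon
  ideals of \<open>I\<close> and \<open>Q i\<close> agree.\<close>

lemma ex_separating_element:
  assumes i: "i \<in> {1..r}"
  obtains f where "f \<notin> Q i" "\<And>g. g * f \<in> Q i \<Longrightarrow> g * f \<in> I"
proof -
  have "\<exists>f. f \<notin> I \<and> (\<forall>j\<in>{1..r} - {i}. f \<in> Q j)" using irredundant[OF i] I_eq by blast
  then obtain f where f: "f \<notin> I" "\<And>j. j \<in> {1..r} - {i} \<Longrightarrow> f \<in> Q j" by blast
  show ?thesis
  proof (rule that)
    show "f \<notin> Q i" using f I_eq by blast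
    fix g assume "g * f \<in> Q i"
    moreover have "g * f \<in> Q j" if "j \<in> {1..r} - {i}" for j
      using f(2)[OF that] ideal_closed(4)[OF is_ideal_Q] that by blast
    ultimately show "g * f \<in> I" using I_eq by blast
  qed
qed

lemma monomial_radical:
  assumes "i \<in> {1..r}"
  shows "monomial_ideal (ideal_radical (Q i))"
proof -
  obtain f where "f \<notin> Q i" "\<And>g. g * f \<in> Q i \<Longrightarrow> g * f \<in> I"
    by (rule ex_separating_element[OF assms]) blast
  then show ?thesis
    using monomial_ideal_radical[OF monomial_I primary I_subset] assms by blast
qed

text \<open>Let \<open>f\<close> be a separating element and \<open>h f\<close> a multiple of it outside \<open>Q i\<close> that the variables of the
  radical multiply into \<open>Q i\<close>. The annihilator of \<open>h f\<close> modulo \<open>I\<close> is then the whole radical, which is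
  therefore an associated prime; as it is not embedded, it is minimal.\<close>

lemma radical_minimal_prime:
  assumes i: "i \<in> {1..r}"
  shows "ideal_radical (Q i) \<in> minimal_primes I"
proof -
  let ?P = "ideal_radical (Q i)"
  note prime = prime_radical[OF i] and P = monomial_radical[OF i] and iQ = is_ideal_Q[OF i]
  obtain f where f: "f \<notin> Q i" "\<And>g. g * f \<in> Q i \<Longrightarrow> g * f \<in> I"
    by (rule ex_separating_element[OF i]) blast
  let ?A = "(\<lambda>l. monomial (Poly_Mapping.single l 1)) ` {l. monomial (Poly_Mapping.single l 1) \<in> ?P}"
  have "\<exists>h. h * f \<notin> Q i \<and> (\<forall>x\<in>?A. x * (h * f) \<in> Q i)"
    by (rule ex_multiple_killed_by_radical_elements[OF iQ _ _ f(1)]) auto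
  then obtain h where h: "h * f \<notin> Q i" "\<And>x. x \<in> ?A \<Longrightarrow> x * (h * f) \<in> Q i" by blast
  have "q * (h * f) \<in> Q i" if "q \<in> ?P" for q
  proof -
    have "exps ?P \<subseteq> exps {q. q * (h * f) \<in> Q i}"
    proof
      fix a assume "a \<in> exps ?P"
      then obtain l where l: "l \<in> keys a" "monomial (Poly_Mapping.single l 1) \<in> ?P"
        unfolding exps_prime_ideal_iff[OF prime] by blast
      have "Poly_Mapping.single l 1 \<in> exps {q. q * (h * f) \<in> Q i}"
        using h(2) l(2) by (simp add: exps_def)
      then show "a \<in> exps {q. q * (h * f) \<in> Q i}"
        using exponent_remove_variable[OF l(1)] exps_add_right[OF is_ideal_colon[OF iQ]] by metis
    qed
    moreover have "keys q \<subseteq> exps ?P" using that mem_monomial_ideal_iff[OF P] by blast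
    ultimately have "q \<in> {q. q * (h * f) \<in> Q i}"
      by (intro in_ideal_if_keys_subset_exps[OF is_ideal_colon[OF iQ]]) blast
    then show ?thesis by blast
  qed
  moreover have "q \<in> ?P" if "q * (h * f) \<in> Q i" for q
    using primary[OF i] that h(1) unfolding primary_ideal_def by (metis mult.commute)
  moreover have "q * (h * f) \<in> I \<longleftrightarrow> q * (h * f) \<in> Q i" for q
    using f(2)[of "q * h"] I_subset[OF i] by (auto simp: mult.assoc)
  ultimately have "?P = {q. q * (h * f) \<in> I}" by blast
  then have "?P \<in> associated_primes I" using prime unfolding associated_primes_def by blast
  then show ?thesis using unmixed unfolding embedded_primes_def by blast
qed

text \<open>A prime that contains the intersection of the components contains one of them.\<close>

lemma minimal_primes_eq: "minimal_primes I = (\<lambda>i. ideal_radical (Q i)) ` {1..r}"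
proof
  show "(\<lambda>i. ideal_radical (Q i)) ` {1..r} \<subseteq> minimal_primes I"
    using radical_minimal_prime by blast
  show "minimal_primes I \<subseteq> (\<lambda>i. ideal_radical (Q i)) ` {1..r}"
  proof
    fix P assume Pm: "P \<in> minimal_primes I"
    then have P: "prime_ideal P" "I \<subseteq> P" by (auto simp: minimal_primes_def)
    have "\<exists>i\<in>{1..r}. Q i \<subseteq> P"
    proof (rule ccontr)
      assume "\<not> (\<exists>i\<in>{1..r}. Q i \<subseteq> P)"
      then have "\<forall>i\<in>{1..r}. \<exists>x. x \<in> Q i \<and> x \<notin> P" by blast
      then obtain x where x: "\<And>i. i \<in> {1..r} \<Longrightarrow> x i \<in> Q i \<and> x i \<notin> P" by metis
      have "prod x {1..r} \<in> Q i" if i: "i \<in> {1..r}" for i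
        using prod.remove[of "{1..r}" i x] i x[OF i] ideal_closed(5)[OF is_ideal_Q[OF i]] by simp
      then have "prod x {1..r} \<in> P" using P(2) I_eq by blast
      then show False using prime_ideal_prod[OF P(1)] x by blast
    qed
    then obtain i where i: "i \<in> {1..r}" "Q i \<subseteq> P" by blast
    have "ideal_radical (Q i) \<subseteq> P" by (rule ideal_radical_subset_prime[OF P(1) i(2)])
    moreover have "I \<subseteq> ideal_radical (Q i)" using I_subset[OF i(1)] subset_ideal_radical by blast
    ultimately have "ideal_radical (Q i) = P"
      using Pm prime_radical[OF i(1)] unfolding minimal_primes_def by blast
    then show "P \<in> (\<lambda>i. ideal_radical (Q i)) ` {1..r}" using i(1) by blast
  qed
qed

text \<open>Distinct minimal primes are incomparable, so every other component contains a monomial outside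
  the radical of \<open>Q i\<close>. The product of these monomials multiplies \<open>Q i\<close> into every component.\<close>

lemma ex_monomial_multiplier:
  assumes i: "i \<in> {1..r}"
  obtains b where "monomial b \<notin> ideal_radical (Q i)" "\<And>q. q \<in> Q i \<Longrightarrow> monomial b * q \<in> I"
proof -
  let ?P = "ideal_radical (Q i)"
  have "\<exists>c. monomial c \<in> Q j \<and> monomial c \<notin> ?P" if j: "j \<in> {1..r} - {i}" for j
  proof -
    have "\<not> ideal_radical (Q j) \<subseteq> ?P"
    proof
      assume "ideal_radical (Q j) \<subseteq> ?P"
      then have "ideal_radical (Q j) = ?P"
        using radical_minimal_prime[OF i] radical_minimal_prime[of j] j
        unfolding minimal_primes_def by blast
      then show False using radical_inj i j unfolding inj_on_def by blast
    qed
    then have "\<not> exps (ideal_radical (Q j)) \<subseteq> exps ?P"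
      using mem_monomial_ideal_iff[OF monomial_radical] i j by blast
    then obtain a where a: "monomial a \<in> ideal_radical (Q j)" "monomial a \<notin> ?P"
      by (auto simp: exps_def)
    then obtain m where "monomial a ^ m \<in> Q j" by (auto simp: ideal_radical_def)
    moreover have "monomial a ^ m \<notin> ?P" using a(2) prime_ideal_power[OF prime_radical[OF i]] by blast
    ultimately show ?thesis unfolding monomial_power by blast
  qed
  then obtain c where c: "\<And>j. j \<in> {1..r} - {i} \<Longrightarrow> monomial (c j) \<in> Q j \<and> monomial (c j) \<notin> ?P"
    by metis
  define b where "b = (\<Sum>j\<in>{1..r} - {i}. c j)"
  have prod: "monomial (sum c F) = (\<Prod>j\<in>F. monomial (c j))" if "finite F" for F
    using that by (induction F rule: finite_induct) (simp_all add: monomial_add del: mult_single)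
  show ?thesis
  proof (rule that[of b])
    show "monomial b \<notin> ?P"
      using prime_ideal_prod[OF prime_radical[OF i], of "{1..r} - {i}" "\<lambda>j. monomial (c j)"] c
      unfolding b_def by (subst prod) auto
    fix q assume q: "q \<in> Q i"
    have "monomial b * q \<in> Q j" if j: "j \<in> {1..r}" for j
    proof (cases "j = i")
      case True
      then show ?thesis using q ideal_closed(4)[OF is_ideal_Q[OF i]] by simp
    next
      case False
      then have "b = c j + sum c ({1..r} - {i} - {j})"
        unfolding b_def using j by (intro sum.remove) auto
      then have "monomial b * q = monomial (c j) * (monomial (sum c ({1..r} - {i} - {j})) * q)"
        by (simp only: monomial_add mult.assoc)
      moreover have "monomial (c j) \<in> Q j" using c[of j] j False by blast
      ultimately show ?thesis using ideal_closed(5)[OF is_ideal_Q[OF j]] by metis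
    qed
    then show "monomial b * q \<in> I" using I_eq by blast
  qed
qed

text \<open>By the previous lemma, and by cancellation modulo the primary ideal \<open>Q i\<close>, the component is the
  colon ideal of the monomial ideal \<open>I\<close> by a monomial.\<close>

lemma monomial_Q:
  assumes i: "i \<in> {1..r}"
  shows "monomial_ideal (Q i)"
proof -
  obtain b where b: "monomial b \<notin> ideal_radical (Q i)" "\<And>q. q \<in> Q i \<Longrightarrow> monomial b * q \<in> I"
    by (rule ex_monomial_multiplier[OF i]) blast
  have "a \<in> exps (Q i)" if q: "q \<in> Q i" and a: "a \<in> keys q" for a q
  proof -
    have "b + a \<in> keys (monomial b * q)" using a by (intro key_of_product) auto
    then have "b + a \<in> exps I" using b(2)[OF q] mem_monomial_ideal_iff[OF monomial_I] by blast
    then have "monomial b * monomial a \<in> Q i"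
      using I_subset[OF i] by (auto simp: exps_def mult_single)
    then show ?thesis using primary_cancel[OF primary[OF i] _ b(1)] by (simp add: exps_def del: mult_single)
  qed
  then show ?thesis using is_ideal_Q[OF i] by (auto simp: monomial_ideal_iff)
qed

text \<open>Locally at the radical of \<open>Q i\<close> the ideals \<open>I\<close> and \<open>Q i\<close> agree, and powers of \<open>Q i\<close> are recovered
  from their localizations by cancellation.\<close>

lemma localized_power_eq:
  assumes i: "i \<in> {1..r}"
  shows "{f. to_fract f \<in> extended_ideal (ideal_pow I k) (ideal_radical (Q i))} = ideal_pow (Q i) k"
proof -
  obtain b where b: "monomial b \<notin> ideal_radical (Q i)" "\<And>q. q \<in> Q i \<Longrightarrow> monomial b * q \<in> I"
    by (rule ex_monomial_multiplier[OF i]) blast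
  have "(\<exists>s. s \<notin> ideal_radical (Q i) \<and> s * f \<in> ideal_pow I k) \<longleftrightarrow> f \<in> ideal_pow (Q i) k" for f
  proof
    assume "\<exists>s. s \<notin> ideal_radical (Q i) \<and> s * f \<in> ideal_pow I k"
    then obtain s where "s \<notin> ideal_radical (Q i)" "f * s \<in> ideal_pow (Q i) k"
      using ideal_pow_mono[OF I_subset[OF i]] by (auto simp: mult.commute)
    then show "f \<in> ideal_pow (Q i) k"
      using ideal_pow_cancel[OF primary monomial_Q monomial_radical] i by blast
  next
    assume "f \<in> ideal_pow (Q i) k"
    then have "monomial b ^ k * f \<in> ideal_pow I k" using power_times_ideal_pow b(2) by blast
    moreover have "monomial b ^ k \<notin> ideal_radical (Q i)"
      using b(1) prime_ideal_power[OF prime_radical[OF i]] by blast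
    ultimately show "\<exists>s. s \<notin> ideal_radical (Q i) \<and> s * f \<in> ideal_pow I k" by blast
  qed
  then show ?thesis
    using to_fract_in_extended_ideal_iff[OF ideal_pow_is_ideal prime_radical[OF i]] by auto
qed

lemma symbolic_power_eq: "symbolic_power I k = (\<Inter>i\<in>{1..r}. ideal_pow (Q i) k)"
  unfolding symbolic_power_def minimal_primes_eq using localized_power_eq by auto

end

section \<open>The cone of the Rees algebra\<close>

lemma exps_ideal_pow_add:
  assumes J: "monomial_ideal J" and "a \<in> exps (ideal_pow J j)" "b \<in> exps (ideal_pow J k)"
  shows "a + b \<in> exps (ideal_pow J (j + k))"
  using assms(2)
proof (induction j arbitrary: a)
  case 0
  then show ?case using exps_add_left[OF ideal_pow_is_ideal assms(3)] by simp
next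
  case (Suc j)
  then obtain c d where "a = c + d" "c \<in> exps J" "d \<in> exps (ideal_pow J j)"
    unfolding exps_ideal_pow_Suc[OF J] by blast
  then show ?case
    using Suc.IH[of d] exps_ideal_pow_superset[of c J "d + b" "j + k"] by (simp add: add.assoc del: ideal_pow.simps)
qed

lemma exps_ideal_pow_sum:
  fixes J :: "('n, 'k::comm_ring_1) polynomial_ring set" and v :: "'i \<Rightarrow> 'n \<Rightarrow>\<^sub>0 nat"
  assumes J: "monomial_ideal J" and "finite F" "\<And>j. j \<in> F \<Longrightarrow> v j \<in> exps (ideal_pow J (m j))"
  shows "(\<Sum>j\<in>F. v j) \<in> exps (ideal_pow J (\<Sum>j\<in>F. m j))"
  using assms(2,3)
proof (induction F rule: finite_induct)
  case (insert x F)
  then show ?case using exps_ideal_pow_add[OF J] by simp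
qed (simp add: exps_ideal_pow_0 del: ideal_pow.simps)

lemma exps_ideal_pow_1: "a \<in> exps J \<Longrightarrow> a \<in> exps (ideal_pow J 1)"
  using exps_ideal_pow_superset[of a J 0 0] by (simp add: exps_ideal_pow_0 del: ideal_pow.simps)

lemma exps_multiple_pow:
  assumes J: "monomial_ideal J" and "a \<in> exps J"
  shows "(\<Sum>i<m. a) \<in> exps (ideal_pow J m)"
  using exps_ideal_pow_sum[OF J, of "{..<m}" "\<lambda>_. a" "\<lambda>_. 1"] exps_ideal_pow_1[OF assms(2)]
  by (simp del: ideal_pow.simps)

lemma exponent_point_add: "exponent_point (a + b) (j + k) = exponent_point a j + exponent_point b k"
  by (simp add: exponent_point_def vec_eq_iff lookup_add)

lemma exponent_point_0_in_cone: "exponent_point a 0 \<in> rees_cone J"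
proof -
  let ?S = "range (\<lambda>i. (axis i 1, 0)) \<union> (\<lambda>v. exponent_point v 1) ` min_gens J :: ((real^'a) \<times> real) set"
  have "(\<chi> i. real (lookup a i), 0 :: real) = (\<Sum>i\<in>UNIV. real (lookup a i) *\<^sub>R (axis i 1, 0))"
    by (simp add: prod_eq_iff fst_sum snd_sum vec_eq_iff axis_def if_distrib cong: if_cong)
  moreover have "(\<Sum>i\<in>F. real (lookup a i) *\<^sub>R (axis i 1, 0)) \<in> convex_cone hull ?S" for F
  proof (cases "finite F")
    case True
    then show ?thesis
    proof (induction F rule: finite_induct)
      case empty
      then show ?case by (simp add: convex_cone_hull_contains_0)
    next
      case (insert x F)
      have "(axis x 1, 0) \<in> convex_cone hull ?S" by (rule hull_inc) auto
      then show ?case using insert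
        by (simp del: scaleR_Pair add: convex_cone_hull_add convex_cone_hull_mul)
    qed
  qed (simp add: convex_cone_hull_contains_0)
  ultimately show ?thesis unfolding rees_cone_def exponent_point_def by simp
qed

lemma exps_min_gens:
  fixes J :: "('n::finite, 'k::comm_ring_1) polynomial_ring set"
  assumes "monomial_ideal J"
  shows "a \<in> exps J \<longleftrightarrow> (\<exists>v\<in>min_gens J. \<exists>u. a = v + u)"
proof -
  have "is_min_gens J (min_gens J)"
    unfolding min_gens_def by (rule theI'[OF ex1_min_gens[OF assms]])
  then have "J = ideal_gen (monomial ` min_gens J)" by (simp add: is_min_gens_def)
  then show ?thesis using monomial_in_ideal_gen[of a "min_gens J", where 'k = 'k] by (simp add: exps_def)
qed

lemma exps_pow_in_rees_cone:
  fixes J :: "('n::finite, 'k::comm_ring_1) polynomial_ring set"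
  assumes J: "monomial_ideal J" and "a \<in> exps (ideal_pow J k)"
  shows "exponent_point a k \<in> rees_cone J"
  using assms(2)
proof (induction k arbitrary: a)
  case 0
  show ?case by (rule exponent_point_0_in_cone)
next
  case (Suc k)
  then obtain c d where cd: "a = c + d" "c \<in> exps J" "d \<in> exps (ideal_pow J k)"
    unfolding exps_ideal_pow_Suc[OF J] by blast
  obtain v u where vu: "v \<in> min_gens J" "c = v + u" using cd(2) unfolding exps_min_gens[OF J] by blast
  have "exponent_point a (Suc k) = exponent_point v 1 + (exponent_point u 0 + exponent_point d k)"
    unfolding cd vu by (simp flip: exponent_point_add add: add.assoc)
  moreover have "exponent_point v 1 \<in> rees_cone J"
    unfolding rees_cone_def using vu(1) by (intro hull_inc) auto
  moreover have "exponent_point u 0 \<in> rees_cone J" by (rule exponent_point_0_in_cone)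
  moreover have "exponent_point d k \<in> rees_cone J" by (rule Suc.IH[OF cd(3)])
  ultimately show ?case unfolding rees_cone_def by (simp add: convex_cone_hull_add)
qed

text \<open>The numbers \<open>c j\<close> are the coefficients of the generators \<open>(v j, 1)\<close>. The coefficients of the unit
  vectors turn into the slack of the inequalities.\<close>

lemma rees_cone_element:
  fixes J :: "('n::finite, 'k::comm_ring_1) polynomial_ring set"
  assumes "x \<in> rees_cone J"
  shows "\<exists>(m::nat) c v. (\<forall>j<m. 0 \<le> c j \<and> v j \<in> min_gens J) \<and> snd x = (\<Sum>j<m. c j) \<and>
    (\<forall>i. (\<Sum>j<m. c j * real (lookup (v j) i)) \<le> fst x $ i)"
proof -
  define T :: "((real^'n) \<times> real) set" where "T = {x. \<exists>(m::nat) c v. (\<forall>j<m. 0 \<le> c j \<and> v j \<in> min_gens J) \<and>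
    snd x = (\<Sum>j<m. c j) \<and> (\<forall>i. (\<Sum>j<m. c j * real (lookup (v j) i)) \<le> fst x $ i)}"
  have "rees_cone J \<subseteq> T"
    unfolding rees_cone_def
  proof (rule hull_minimal)
    show "range (\<lambda>i. (axis i 1, 0)) \<union> (\<lambda>v. exponent_point v 1) ` min_gens J \<subseteq> T"
    proof (intro Un_least image_subsetI)
      fix i :: 'n show "(axis i 1, 0) \<in> T"
        unfolding T_def by (intro CollectI exI[of _ 0]) (simp add: axis_def)
    next
      fix v assume "v \<in> min_gens J"
      then show "exponent_point v 1 \<in> T"
        unfolding T_def
        by (intro CollectI exI[of _ 1] exI[of _ "\<lambda>_. 1"] exI[of _ "\<lambda>_. v"]) (simp add: exponent_point_def)
    qed
    have sum_split: "(\<Sum>j<m + m'. h j) = (\<Sum>j<m. h j) + (\<Sum>j<m'. h (m + j))" for m m' and h :: "nat \<Rightarrow> real"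
      by (induction m') (simp_all add: add.assoc)
    show "convex_cone T"
      unfolding convex_cone_iff
    proof (intro conjI ballI allI impI)
      show "0 \<in> T" unfolding T_def by (intro CollectI exI[of _ 0]) simp
    next
      fix x y assume "x \<in> T" "y \<in> T"
      then obtain m :: nat and c v where
        x: "\<forall>j<m. 0 \<le> c j \<and> v j \<in> min_gens J" "snd x = (\<Sum>j<m. c j)"
          "\<forall>i. (\<Sum>j<m. c j * real (lookup (v j) i)) \<le> fst x $ i"
        unfolding T_def by blast
      obtain m' :: nat and c' v' where
        y: "\<forall>j<m'. 0 \<le> c' j \<and> v' j \<in> min_gens J" "snd y = (\<Sum>j<m'. c' j)"
          "\<forall>i. (\<Sum>j<m'. c' j * real (lookup (v' j) i)) \<le> fst y $ i"
        using \<open>y \<in> T\<close> unfolding T_def by blast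
      let ?c = "\<lambda>j. if j < m then c j else c' (j - m)" and ?v = "\<lambda>j. if j < m then v j else v' (j - m)"
      have "\<forall>j<m + m'. 0 \<le> ?c j \<and> ?v j \<in> min_gens J" using x(1) y(1) by auto
      moreover have "snd (x + y) = (\<Sum>j<m + m'. ?c j)" unfolding sum_split using x(2) y(2) by simp
      moreover have "\<forall>i. (\<Sum>j<m + m'. ?c j * real (lookup (?v j) i)) \<le> fst (x + y) $ i"
        unfolding sum_split using x(3) y(3) by (simp add: add_mono)
      ultimately show "x + y \<in> T"
        unfolding T_def by (intro CollectI exI[of _ "m + m'"] exI[of _ ?c] exI[of _ ?v] conjI)
    next
      fix x and t :: real assume "x \<in> T" "0 \<le> t"
      then obtain m :: nat and c v where
        x: "\<forall>j<m. 0 \<le> c j \<and> v j \<in> min_gens J" "snd x = (\<Sum>j<m. c j)"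
          "\<forall>i. (\<Sum>j<m. c j * real (lookup (v j) i)) \<le> fst x $ i"
        unfolding T_def by blast
      have "\<forall>j<m. 0 \<le> t * c j \<and> v j \<in> min_gens J" using x(1) \<open>0 \<le> t\<close> by simp
      moreover have "snd (t *\<^sub>R x) = (\<Sum>j<m. t * c j)" using x(2) by (simp add: sum_distrib_left)
      moreover have "\<forall>i. (\<Sum>j<m. t * c j * real (lookup (v j) i)) \<le> fst (t *\<^sub>R x) $ i"
        using x(3) \<open>0 \<le> t\<close> by (simp add: mult.assoc mult_left_mono flip: sum_distrib_left)
      ultimately show "t *\<^sub>R x \<in> T"
        unfolding T_def by (intro CollectI exI[of _ m] exI[of _ "\<lambda>j. t * c j"] exI[of _ v] conjI)
    qed
  qed
  then show ?thesis using assms unfolding T_def by blast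
qed

text \<open>A lattice point of the cone is a combination of generators with real coefficients \<open>c\<close>. Simultaneous
  Dirichlet approximation gives a multiplier \<open>q\<close> for which every \<open>q c j\<close> is close to an integer \<open>p j\<close>.
  The \<open>t\<close>-coordinate of the rounded combination and the bound on its other coordinates are integers,
  so a total error below \<open>1\<close> is no error at all: the \<open>p j\<close> represent the \<open>q\<close>-th multiple of the point
  exactly.\<close>

lemma rees_cone_multiple_in_pow:
  fixes J :: "('n::finite, 'k::comm_ring_1) polynomial_ring set"
  assumes J: "monomial_ideal J" and "exponent_point a k \<in> rees_cone J"
  obtains N where "N > 0" "(\<Sum>i<N. a) \<in> exps (ideal_pow J (N * k))"
proof -
  obtain m :: nat and c v where c: "\<And>j. j < m \<Longrightarrow> 0 \<le> c j" and v: "\<And>j. j < m \<Longrightarrow> v j \<in> min_gens J"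
    and k: "real k = (\<Sum>j<m. c j)" and a: "\<And>i. (\<Sum>j<m. c j * real (lookup (v j) i)) \<le> real (lookup a i)"
    using rees_cone_element[OF assms(2)] by (auto simp: exponent_point_def)
  \<comment> \<open>\<open>B\<close> exceeds the sum of all weights by which the approximation errors get multiplied: \<open>m\<close> for the
    coordinate of \<open>t\<close>, the exponents of the generators for the others.\<close>
  define B where "B = 1 + m + (\<Sum>i\<in>UNIV. \<Sum>j<m. lookup (v j) i)"
  have B0: "0 < B" by (simp add: B_def)
  obtain q p where q: "0 < q" "q \<le> int (B ^ m)"
    and p: "\<And>j. j < m \<Longrightarrow> \<bar>of_int q * c j - of_int (p j)\<bar> < 1 / B"
    by (rule Dirichlet_approx_simult[OF B0, of m c]) (rule that)
  have B1: "1 / real B \<le> 1" using B0 by simp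
  have p0: "0 \<le> p j" if "j < m" for j
  proof -
    have "0 \<le> of_int q * c j" using q c[OF that] by simp
    then have "- 1 < real_of_int (p j)" using p[OF that] B1 by linarith
    then show ?thesis by linarith
  qed
  have err: "\<bar>(\<Sum>j<m. of_int q * c j * real (w j)) - (\<Sum>j<m. of_int (p j) * real (w j))\<bar> < 1"
    if w: "(\<Sum>j<m. w j) < B" for w :: "nat \<Rightarrow> nat"
  proof -
    have "\<bar>(\<Sum>j<m. of_int q * c j * real (w j)) - (\<Sum>j<m. of_int (p j) * real (w j))\<bar>
        = \<bar>\<Sum>j<m. (of_int q * c j - of_int (p j)) * real (w j)\<bar>"
      by (simp add: sum_subtractf left_diff_distrib)
    also have "\<dots> \<le> (\<Sum>j<m. 1 / B * real (w j))"
    proof (rule order.trans[OF sum_abs], rule sum_mono)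
      fix j assume "j \<in> {..<m}"
      then have "\<bar>of_int q * c j - of_int (p j)\<bar> \<le> 1 / B" using p less_imp_le by auto
      then have "\<bar>of_int q * c j - of_int (p j)\<bar> * real (w j) \<le> 1 / B * real (w j)"
        by (intro mult_right_mono) auto
      then show "\<bar>(of_int q * c j - of_int (p j)) * real (w j)\<bar> \<le> 1 / B * real (w j)"
        by (simp add: abs_mult)
    qed
    also have "\<dots> = real (\<Sum>j<m. w j) / B"
      by (simp add: sum_divide_distrib)
    also have "\<dots> < 1" using w B0 by (simp del: of_nat_sum)
    finally show ?thesis .
  qed
  have "\<bar>of_int q * real k - of_int (\<Sum>j<m. p j)\<bar> < 1"
    using err[of "\<lambda>_. 1"] by (simp add: B_def k sum_distrib_left)
  then have "\<bar>real_of_int (q * int k - (\<Sum>j<m. p j))\<bar> < 1" by simp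
  then have pk: "(\<Sum>j<m. p j) = q * int k" by linarith
  have pa: "(\<Sum>j<m. p j * int (lookup (v j) i)) \<le> q * int (lookup a i)" for i
  proof -
    have "(\<Sum>j<m. lookup (v j) i) < B"
      using member_le_sum[of i UNIV "\<lambda>i. \<Sum>j<m. lookup (v j) i"] by (simp add: B_def)
    from err[OF this]
    have "of_int (\<Sum>j<m. p j * int (lookup (v j) i)) < (\<Sum>j<m. of_int q * c j * real (lookup (v j) i)) + 1"
      by (simp add: abs_less_iff)
    also have "(\<Sum>j<m. of_int q * c j * real (lookup (v j) i)) \<le> of_int q * real (lookup a i)"
      using a[of i] q by (simp add: mult.assoc flip: sum_distrib_left)
    finally have "of_int (\<Sum>j<m. p j * int (lookup (v j) i)) < real_of_int (q * int (lookup a i)) + 1"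
      by simp
    then show ?thesis by linarith
  qed
  define N where "N = nat q"
  define n where "n j = nat (p j)" for j
  have N: "q = int N" using q by (simp add: N_def)
  have n: "p j = int (n j)" if "j < m" for j using p0[OF that] by (simp add: n_def)
  have nk: "(\<Sum>j<m. n j) = N * k"
  proof -
    have "(\<Sum>j<m. p j) = int (\<Sum>j<m. n j)" by (simp add: n)
    then have "int (\<Sum>j<m. n j) = int (N * k)" using pk by (simp add: N)
    then show ?thesis by (simp only: of_nat_eq_iff)
  qed
  have na: "(\<Sum>j<m. n j * lookup (v j) i) \<le> N * lookup a i" for i
  proof -
    have "(\<Sum>j<m. p j * int (lookup (v j) i)) = int (\<Sum>j<m. n j * lookup (v j) i)" by (simp add: n)
    then have "int (\<Sum>j<m. n j * lookup (v j) i) \<le> int (N * lookup a i)" using pa[of i] by (simp add: N)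
    then show ?thesis by (simp only: of_nat_le_iff)
  qed
  define b where "b = (\<Sum>j<m. \<Sum>i<n j. v j)"
  have b: "b \<in> exps (ideal_pow J (N * k))"
    unfolding b_def nk[symmetric]
  proof (intro exps_ideal_pow_sum[OF J] exps_multiple_pow[OF J])
    fix j assume "j \<in> {..<m}"
    then show "v j \<in> exps J" using v[of j] exps_min_gens[OF J] self_witness[of "v j"] by auto
  qed simp
  have "(\<Sum>i<N. a) = ((\<Sum>i<N. a) - b) + b"
    by (rule poly_mapping_eqI) (use na in \<open>simp add: lookup_add lookup_minus b_def lookup_sum\<close>)
  then have "(\<Sum>i<N. a) \<in> exps (ideal_pow J (N * k))"
    using exps_add_left[OF ideal_pow_is_ideal b] by metis
  moreover have "N > 0" using q by (simp add: N_def)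
  ultimately show ?thesis using that by blast
qed

section \<open>Normality\<close>

lemma monom_in_rees_algebra_iff: "monom f k \<in> rees_algebra J \<longleftrightarrow> f \<in> ideal_pow J k"
  unfolding rees_algebra_def using ideal_closed(1)[OF ideal_pow_is_ideal[of J]]
  by (auto simp: coeff_monom)

lemma to_fract_mem_iff: "to_fract z \<in> to_fract ` A \<longleftrightarrow> z \<in> A"
  by (auto simp: eq_fract)

lemma to_fract_power: "to_fract z ^ n = to_fract (z ^ n)"
  by (induction n) (simp_all add: One_fract_def)

lemma root_integral:
  fixes A :: "'a::idom set"
  assumes "0 \<in> A" "1 \<in> A" "- (z ^ N) \<in> A" "N > 0"
  shows "integral_over A (to_fract z)"
  unfolding integral_over_def
proof (intro exI[of _ "monom 1 N + [:- to_fract (z ^ N):]"] conjI allI)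
  let ?p = "monom 1 N + [:- to_fract (z ^ N):]"
  have "degree ?p = N" using assms(4) by (subst degree_add_eq_left) (simp_all add: degree_monom_eq)
  then show "lead_coeff ?p = 1" using assms(4) by (simp add: coeff_pCons split: nat.split)
  show "poly ?p (to_fract z) = 0" by (simp add: poly_monom to_fract_power del: minus_fract)
  fix i
  have "coeff ?p i \<in> {to_fract 0, to_fract 1, to_fract (- (z ^ N))}"
    using assms(4) by (auto simp: coeff_pCons Zero_fract_def One_fract_def split: nat.split)
  then show "coeff ?p i \<in> to_fract ` A" using assms by auto
qed

text \<open>For \<open>z = x^a t^k\<close>, some power of \<open>z\<close> lies in the Rees algebra, so \<open>z\<close> is integral over it. It is also
  a fraction of elements of the Rees algebra, as multiplication by the \<open>k\<close>-th power of a monomial of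
  \<open>J\<close> moves it into the algebra. Normality then gives \<open>z\<close> itself.\<close>

lemma normal_rees_cone_in_pow:
  fixes J :: "('n::{finite,linorder}, 'k::field) polynomial_ring set"
  assumes J: "monomial_ideal J" and normal: "normal_subring (rees_algebra J)"
    and cone: "exponent_point a k \<in> rees_cone J"
  shows "a \<in> exps (ideal_pow J k)"
proof (cases "k = 0")
  case True
  then show ?thesis by (simp add: exps_ideal_pow_0 del: ideal_pow.simps)
next
  case False
  obtain N where N: "N > 0" "(\<Sum>i<N. a) \<in> exps (ideal_pow J (N * k))"
    by (rule rees_cone_multiple_in_pow[OF J cone]) blast
  define z :: "('n, 'k) polynomial_ring poly" where "z = monom (monomial a) k"
  \<comment> \<open>\<open>J = 0\<close> has to be excluded: its Rees algebra has no fraction that involves \<open>t\<close>.\<close>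
  have "exps J \<noteq> {}"
  proof
    assume "exps J = {}"
    then have "exps (ideal_pow J (Suc l)) = {}" for l unfolding exps_ideal_pow_Suc[OF J] by simp
    moreover have "N * k = Suc (N * k - 1)" using N(1) False by simp
    ultimately show False using N(2) by (metis empty_iff)
  qed
  then obtain v where v: "v \<in> exps J" by blast
  define y :: "('n, 'k) polynomial_ring poly" where "y = monom (monomial (\<Sum>i<k. v)) 0"
  have y0: "y \<noteq> 0" by (simp add: y_def monom_eq_0_iff flip: keys_eq_empty)
  have "y \<in> rees_algebra J" unfolding y_def monom_in_rees_algebra_iff by simp
  moreover have "z * y = monom (monomial (a + (\<Sum>i<k. v))) k"
    by (simp add: z_def y_def mult_monom mult_single)
  then have "z * y \<in> rees_algebra J"
    using exps_add_left[OF ideal_pow_is_ideal exps_multiple_pow[OF J v]]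
    by (simp only: monom_in_rees_algebra_iff) (simp add: exps_def)
  moreover have "to_fract z = Fract (z * y) y" using y0 by (simp add: eq_fract)
  ultimately have frac: "to_fract z \<in> subring_fractions (rees_algebra J)"
    unfolding subring_fractions_def using y0 by blast
  have "z ^ N = monom (monomial (\<Sum>i<N. a)) (N * k)"
    by (simp add: z_def monom_power monomial_power mult.commute)
  then have "- (z ^ N) = monom (- monomial (\<Sum>i<N. a)) (N * k)" by (simp add: minus_monom)
  moreover have "- monomial (\<Sum>i<N. a) \<in> ideal_pow J (N * k)"
    using N(2) ideal_closed(6)[OF ideal_pow_is_ideal] by (auto simp: exps_def)
  ultimately have "- (z ^ N) \<in> rees_algebra J" by (simp only: monom_in_rees_algebra_iff)
  moreover have "0 \<in> rees_algebra J"
    using ideal_closed(1)[OF ideal_pow_is_ideal] by (auto simp: rees_algebra_def)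
  moreover have "1 \<in> rees_algebra J"
    using monom_in_rees_algebra_iff[of 1 0 J] by (simp add: monom_0 one_pCons)
  ultimately have "integral_over (rees_algebra J) (to_fract z)" using root_integral N(1) by blast
  then have "to_fract z \<in> to_fract ` rees_algebra J"
    using normal frac unfolding normal_subring_def by blast
  then have "z \<in> rees_algebra J" by (simp only: to_fract_mem_iff)
  then show ?thesis unfolding z_def monom_in_rees_algebra_iff by (simp add: exps_def)
qed

lemma exps_pow_iff_rees_cone:
  fixes J :: "('n::{finite,linorder}, 'k::field) polynomial_ring set"
  assumes "monomial_ideal J" "normal_subring (rees_algebra J)"
  shows "a \<in> exps (ideal_pow J k) \<longleftrightarrow> exponent_point a k \<in> rees_cone J"
  using assms exps_pow_in_rees_cone normal_rees_cone_in_pow by blast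

section \<open>The semigroup ring\<close>

lemma module_scalars:
  "module (\<lambda>c :: 'k::field. smult (Poly_Mapping.single 0 c) :: ('n::finite, 'k) polynomial_ring poly \<Rightarrow> _)"
  by unfold_locales
    (simp_all add: smult_add_right single_add smult_add_left mult_single)

lemma monom_sum: "monom (\<Sum>i\<in>F. f i) k = (\<Sum>i\<in>F. monom (f i) k)"
  by (induction F rule: infinite_finite_induct) (simp_all add: add_monom[symmetric])

lemma polynomial_sum_of_terms:
  fixes f :: "'a \<Rightarrow>\<^sub>0 'b::ab_group_add"
  shows "f = (\<Sum>a\<in>keys f. Poly_Mapping.single a (lookup f a))"
  by (rule poly_mapping_eqI)
    (auto simp: lookup_sum lookup_single when_def in_keys_iff sum.delta)

lemma semigroup_ring_iff:
  fixes p :: "('n::finite, 'k::field) polynomial_ring poly"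
  shows "p \<in> semigroup_ring S \<longleftrightarrow> (\<forall>k. \<forall>a\<in>keys (coeff p k). exponent_point a k \<in> S)"
proof
  let ?T = "{p :: ('n, 'k) polynomial_ring poly. \<forall>k. \<forall>a\<in>keys (coeff p k). exponent_point a k \<in> S}"
  have "semigroup_ring S \<subseteq> ?T"
    unfolding semigroup_ring_def
  proof (rule module.span_minimal[OF module_scalars])
    show "{monom (monomial a) b |a b. exponent_point a b \<in> S} \<subseteq> ?T"
      by (auto simp: coeff_monom split: if_splits)
    show "module.subspace (\<lambda>c. smult (Poly_Mapping.single 0 c)) ?T"
      unfolding module.subspace_def[OF module_scalars]
    proof (intro conjI ballI allI CollectI)
      fix p q k a assume "p \<in> ?T" "q \<in> ?T" "a \<in> keys (coeff (p + q) k)"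
      then show "exponent_point a k \<in> S" using keys_add[of "coeff p k" "coeff q k"] by auto
    next
      fix c p k a assume "p \<in> ?T" "a \<in> keys (coeff (smult (Poly_Mapping.single 0 c) p) k)"
      then show "exponent_point a k \<in> S"
        using keys_mult[of "Poly_Mapping.single 0 c" "coeff p k"] by (auto split: if_splits)
    qed simp
  qed
  then show "\<forall>k. \<forall>a\<in>keys (coeff p k). exponent_point a k \<in> S" if "p \<in> semigroup_ring S"
    using that by blast
  assume p: "\<forall>k. \<forall>a\<in>keys (coeff p k). exponent_point a k \<in> S"
  have "monom (Poly_Mapping.single a c) k \<in> semigroup_ring S" if "exponent_point a k \<in> S" for a k and c :: 'k
  proof -
    have "smult (Poly_Mapping.single 0 c) (monom (monomial a) k) \<in> semigroup_ring S"
      unfolding semigroup_ring_def using that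
      by (intro module.span_scale[OF module_scalars] module.span_base[OF module_scalars]) blast
    then show ?thesis by (simp add: smult_monom mult_single)
  qed
  then have "(\<Sum>a\<in>keys (coeff p k). monom (Poly_Mapping.single a (lookup (coeff p k) a)) k)
      \<in> semigroup_ring S" for k
    using p unfolding semigroup_ring_def by (intro module.span_sum[OF module_scalars]) simp
  then have "monom (coeff p k) k \<in> semigroup_ring S" for k
    unfolding monom_sum[symmetric] polynomial_sum_of_terms[symmetric] .
  then have "(\<Sum>k\<le>degree p. monom (coeff p k) k) \<in> semigroup_ring S"
    unfolding semigroup_ring_def by (intro module.span_sum[OF module_scalars])
  then show "p \<in> semigroup_ring S" by (simp add: poly_as_sum_of_monoms)
qed

section \<open>The symbolic Rees algebra\<close>

theorem proposition4:
  fixes I :: "('n::{finite,linorder}, 'k::field) polynomial_ring set"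
    and Q :: "nat \<Rightarrow> ('n, 'k) polynomial_ring set"
    and r :: nat
    and H :: "((real^'n::{finite,linorder}) \<times> real) set"
  assumes "monomial_ideal I"
    and "embedded_primes I = {}"
    and "r \<ge> 1"
    and "minimal_primary_decomposition I r Q"
    and "\<And>i. i \<in> {1..r} \<Longrightarrow> normal_subring (rees_algebra (Q i))"
    and "hilbert_basis H (\<Inter>i\<in>{1..r}. rees_cone (Q i))"
  shows "symbolic_rees_algebra I = semigroup_ring (nat_combinations H)"
proof -
  interpret unmixed_monomial_decomposition I Q r by unfold_locales fact+
  have H: "nat_combinations H = (\<Inter>i\<in>{1..r}. rees_cone (Q i)) \<inter> lattice_points"
    using assms(6) by (simp add: hilbert_basis_def)
  have lattice: "exponent_point a k \<in> lattice_points" for a :: "'n \<Rightarrow>\<^sub>0 nat" and k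
    by (simp add: exponent_point_def lattice_points_def)
  have "p \<in> symbolic_rees_algebra I \<longleftrightarrow> p \<in> semigroup_ring (nat_combinations H)" for p
  proof -
    have "p \<in> symbolic_rees_algebra I \<longleftrightarrow>
        (\<forall>k. \<forall>i\<in>{1..r}. keys (coeff p k) \<subseteq> exps (ideal_pow (Q i) k))"
      by (simp add: symbolic_rees_algebra_def symbolic_power_eq
          mem_monomial_ideal_iff[OF monomial_ideal_pow[OF monomial_Q]] del: One_nat_def)
    also have "\<dots> \<longleftrightarrow>
        (\<forall>k. \<forall>a\<in>keys (coeff p k). \<forall>i\<in>{1..r}. exponent_point a k \<in> rees_cone (Q i))"
      using exps_pow_iff_rees_cone[OF monomial_Q assms(5)] by blast
    also have "\<dots> \<longleftrightarrow> p \<in> semigroup_ring (nat_combinations H)"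
      by (simp add: semigroup_ring_iff H lattice)
    finally show ?thesis .
  qed
  then show ?thesis by blast
qed

end
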